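(* Let $X,Y\in\mathrm{Sym}^+(p)$ with $X\neq Y$, and let $(U,D)\in\mathcal{E}_X$, $(V,\Lambda)\in\mathcal{E}_Y$. For $i=1,2$ assume that $\chi_i=F\circ\gamma_i$ is a minimal smooth scaling-rotation (MSSR) curve from $X$ to $Y$ corresponding to the minimal pair $((UR_{U,i},D),(VR_{V,i}P_{g_i}^{-1},\Lambda_i))$, where $R_{U,i}\in G_D^0$, $R_{V,i}\in G_\Lambda^0$, $g_i\in\tilde{S}_p^+$, $\Lambda_i=\pi_{g_i}\cdot\Lambda$, and $\gamma_i:[0,1]\to M(p)$ is a geodesic (an $F$-minimal geodesic whose endpoints $\gamma_i(0),\gamma_i(1)$ form this minimal pair). (The two minimal pairs are not assumed to be distinct.) Then $\chi_1=\chi_2$ if and only if the following two conditions hold. (i) Either both pairs $(UR_{U,i},VR_{V,i}P_{g_i}^{-1})$, $i=1,2$, are geodesically non-antipodal and $$R_{V,2}P_{g_2}^{-1}R_{U,2}^{-1}=R_{V,1}P_{g_1}^{-1}R_{U,1}^{-1},$$ or both pairs are geodesically antipodal and $$(\mathrm{proj}_{SO(p)}\gamma_1'(0))R_{U,1}^{-1}=(\mathrm{proj}_{SO(p)}\gamma_2'(0))R_{U,2}^{-1},$$ where for any $(U',D')\in M(p)$, $\mathrm{proj}_{SO(p)}$ denotes the natural projection $T_{(U',D')}M(p)\to T_{U'}SO(p)$ (tangent vectors to $SO(p)$ being regarded as $p\times p$ matrices). (ii) There exist $g\in\tilde{S}_p^+$ and $R\in G_{D,\Lambda_1}^0$ such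 that $$D=\pi_g\cdot D,\qquad \Lambda_2=\pi_g\cdot\Lambda_1,\qquad R_{U,1}^{-1}R_{U,2}=RP_g^{-1}.$$ Moreover, the equality $(\mathrm{proj}_{SO(p)}\gamma_1'(0))R_{U,1}^{-1}=(\mathrm{proj}_{SO(p)}\gamma_2'(0))R_{U,2}^{-1}$ implies the equality $R_{V,2}P_{g_2}^{-1}R_{U,2}^{-1}=R_{V,1}P_{g_1}^{-1}R_{U,1}^{-1}$, so the equality $R_{V,2}P_{g_2}^{-1}R_{U,2}^{-1}=R_{V,1}P_{g_1}^{-1}R_{U,1}^{-1}$ is always a necessary condition for the equality $\chi_1=\chi_2$.
   Context: Let $p\ge 2$. $\mathrm{Sym}^+(p)$ is the set of $p\times p$ real symmetric positive-definite matrices, $\mathrm{Diag}^+(p)$ the set of $p\times p$ diagonal matrices with positive diagonal entries, $M(p)=SO(p)\times \mathrm{Diag}^+(p)$, $F:M(p)\to \mathrm{Sym}^+(p)$, $F(U,D)=UDU^T$, and $\mathcal{E}_X=F^{-1}(X)$. Metrics: $SO(p)$ carries the bi-invariant Riemannian metric $g_{SO}$ given at the identity by $g_{SO}(A_1,A_2)=-\frac12\mathrm{tr}(A_1A_2)$; $\mathrm{Diag}^+(p)$ carries the metric $g_{\mathcal{D}^+}|_D(L_1,L_2)=\mathrm{tr}(D^{-1}L_1D^{-1}L_2)$; $M(p)$ carries $g_M=k\,g_{SO}\oplus g_{\mathcal{D}^+}$ with fixed $k>0$, with distance function $d_M$. The scaling-rotation distance is $d_{\mathcal{SR}}(X,Y)=\inf\{d_M(a,b):a\in\mathcal{E}_X,b\in\mathcal{E}_Y\}$.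 An $F$-minimal geodesic from $\mathcal{E}_X$ to $\mathcal{E}_Y$ is a geodesic $\gamma:[0,1]\to M(p)$ with $\gamma(0)\in\mathcal{E}_X$, $\gamma(1)\in\mathcal{E}_Y$ and length $d_{\mathcal{SR}}(X,Y)$. A minimal pair is a pair $(\gamma(0),\gamma(1))$ for such a $\gamma$. An MSSR curve from $X$ to $Y$ is a map $\chi=F\circ\gamma$ with $\gamma$ an $F$-minimal geodesic; it corresponds to the minimal pair formed by the endpoints of $\gamma$. A pair $(U,V)\in SO(p)\times SO(p)$ is geodesically antipodal if one point is in the cut-locus of the other (in $(SO(p),g_{SO})$), equivalently if $V^{-1}U$ is an involution ($R^2=I\ne R$); otherwise it is geodesically non-antipodal. Groups: $\tilde{S}_p^+$ is the group of even signed-permutations, identified with the group of matrices in $SO(p)$ having exactly one nonzero entry in each row and column, each nonzero entry being $\pm1$; the matrix of $g$ is $P_g$, and $\pi_g\in S_p$ is the underlying permutation. $S_p$ acts on diagonal matrices by permuting diagonal entries, so $\pi_g\cdot D=P_gDP_g^{-1}$. For diagonal matrices $D,L$: $G_D=\{R\in SO(p):RDR^T=D\}$, $G_{D,L}=G_D\cap G_L$, and a superscript $0$ denotes the identity component. *)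

theory Defs
  imports "HOL-Analysis.Analysis"
begin

section \<open>Submanifolds of a normed space with a Riemannian metric\<close>

text \<open>
  A Riemannian manifold is given here as a subset \<open>N\<close> of a normed space, the tangent spaces
  \<open>T x\<close> for \<open>x\<close> in \<open>N\<close> as subspaces of the same normed space, and a metric tensor
  \<open>G x u v\<close>. The formula for \<open>G\<close> is also meaningful at points near \<open>N\<close> and is
  symmetric and bilinear in \<open>u\<close>, \<open>v\<close> there.
\<close>

text \<open>
  The geodesic equation (vanishing of the Levi-Civita covariant derivative of the velocity)
  in coordinates of the ambient space, tested against tangent vectors \<open>w\<close>: with Christoffel
  symbols of the first kind it reads
  \<open>G(\<gamma>'', w) + (\<partial>_{\<gamma>'} G)(\<gamma>', w) - 1/2 (\<partial>_w G)(\<gamma>', \<gamma>') = 0\<close>.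
  Since \<open>w\<close> is tangent, the left-hand side is the inner product of \<open>w\<close> with the covariant
  derivative of \<open>\<gamma>'\<close> in \<open>N\<close>, and does not depend on how the metric is extended off \<open>N\<close>.
\<close>

definition metric_deriv ::
  "('a::real_normed_vector \<Rightarrow> 'a \<Rightarrow> 'a \<Rightarrow> real) \<Rightarrow> 'a \<Rightarrow> 'a \<Rightarrow> 'a \<Rightarrow> 'a \<Rightarrow> real" where
  "metric_deriv G x w u v = deriv (\<lambda>s. G (x + s *\<^sub>R w) u v) 0"

definition geodesic_on ::
  "('a::real_normed_vector \<Rightarrow> 'a \<Rightarrow> 'a \<Rightarrow> real) \<Rightarrow> ('a \<Rightarrow> 'a set) \<Rightarrow> 'a set \<Rightarrow> real set
    \<Rightarrow> (real \<Rightarrow> 'a) \<Rightarrow> bool" where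
  "geodesic_on G T N J \<gamma> \<longleftrightarrow>
     (\<forall>t\<in>J. \<gamma> t \<in> N) \<and>
     (\<exists>\<gamma>' \<gamma>''. \<forall>t\<in>J.
        (\<gamma> has_vector_derivative \<gamma>' t) (at t within J) \<and>
        (\<gamma>' has_vector_derivative \<gamma>'' t) (at t within J) \<and>
        (\<forall>w\<in>T (\<gamma> t).
           G (\<gamma> t) (\<gamma>'' t) w + metric_deriv G (\<gamma> t) (\<gamma>' t) (\<gamma>' t) w
             - 1/2 * metric_deriv G (\<gamma> t) w (\<gamma>' t) (\<gamma>' t) = 0))"

definition speed ::
  "('a::real_normed_vector \<Rightarrow> 'a \<Rightarrow> 'a \<Rightarrow> real) \<Rightarrow> (real \<Rightarrow> 'a) \<Rightarrow> real \<Rightarrow> real" where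
  "speed G c t =
     (let v = vector_derivative c (at t within {0..1}) in sqrt (G (c t) v v))"

definition curve_length ::
  "('a::real_normed_vector \<Rightarrow> 'a \<Rightarrow> 'a \<Rightarrow> real) \<Rightarrow> (real \<Rightarrow> 'a) \<Rightarrow> real" where
  "curve_length G c = integral {0..1} (speed G c)"

text \<open>
  The library's piecewise \<open>C\<^sup>1\<close> paths may have unbounded derivative near a break point, so that
  their length can be infinite; integrability of the speed excludes these (the Henstock-Kurzweil
  integral would be \<open>0\<close> for them).
\<close>

definition riem_dist ::
  "('a::real_normed_vector \<Rightarrow> 'a \<Rightarrow> 'a \<Rightarrow> real) \<Rightarrow> 'a set \<Rightarrow> 'a \<Rightarrow> 'a \<Rightarrow> real" where
  "riem_dist G N a b =
     Inf {curve_length G c | c. valid_path c \<and> path_image c \<subseteq> N \<and> speed G c integrable_on {0..1} \<and>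
            pathstart c = a \<and> pathfinish c = b}"

text \<open>
  The cut locus of \<open>q\<close>: the points \<open>\<gamma> t0\<close> where \<open>\<gamma>\<close> is a unit-speed geodesic from \<open>q\<close> and
  \<open>t0\<close> is the last parameter up to which \<open>\<gamma>\<close> is minimizing.
\<close>

definition cut_locus ::
  "('a::real_normed_vector \<Rightarrow> 'a \<Rightarrow> 'a \<Rightarrow> real) \<Rightarrow> ('a \<Rightarrow> 'a set) \<Rightarrow> 'a set \<Rightarrow> 'a \<Rightarrow> 'a set" where
  "cut_locus G T N q =
     {\<gamma> t0 | \<gamma> t0. geodesic_on G T N {0..} \<gamma> \<and> \<gamma> 0 = q \<and>
        (\<forall>t\<ge>0. let v = vector_derivative \<gamma> (at t within {0..}) in G (\<gamma> t) v v = 1) \<and>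
        0 < t0 \<and> {t. 0 \<le> t \<and> riem_dist G N q (\<gamma> t) = t} = {0..t0}}"


section \<open>Matrices\<close>

type_synonym 'n sqmat = "real ^ 'n ^ 'n"

definition SO :: "('n::finite) sqmat set" where
  "SO = {U. rotation_matrix U}"

definition diagonal_mat :: "('n::finite) sqmat \<Rightarrow> bool" where
  "diagonal_mat L \<longleftrightarrow> (\<forall>i j. i \<noteq> j \<longrightarrow> L $ i $ j = 0)"

definition DiagP :: "('n::finite) sqmat set" where
  "DiagP = {D. diagonal_mat D \<and> (\<forall>i. 0 < D $ i $ i)}"

definition SymP :: "('n::finite) sqmat set" where
  "SymP = {X. transpose X = X \<and> (\<forall>v. v \<noteq> 0 \<longrightarrow> 0 < v \<bullet> (X *v v))}"

definition Mp :: "(('n::finite) sqmat \<times> 'n sqmat) set" where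
  "Mp = SO \<times> DiagP"

definition F :: "('n::finite) sqmat \<times> 'n sqmat \<Rightarrow> 'n sqmat" where
  "F = (\<lambda>(U, D). U ** D ** transpose U)"

definition fiber :: "('n::finite) sqmat \<Rightarrow> ('n sqmat \<times> 'n sqmat) set" where
  "fiber X = {m \<in> Mp. F m = X}"


section \<open>The Riemannian manifolds SO(p) and M(p)\<close>

definition tangent_SO :: "('n::finite) sqmat \<Rightarrow> 'n sqmat set" where
  "tangent_SO U = {A. transpose (transpose U ** A) = - (transpose U ** A)}"

definition tangent_M :: "('n::finite) sqmat \<times> 'n sqmat \<Rightarrow> ('n sqmat \<times> 'n sqmat) set" where
  "tangent_M = (\<lambda>(U, D). tangent_SO U \<times> {L. diagonal_mat L})"

text \<open>
  Left translation to the identity of \<open>-1/2 tr (A B)\<close>; on \<open>SO(p)\<close>, where \<open>U\<^sup>T\<close> is the inverse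
  of \<open>U\<close>, this is the bi-invariant metric.
\<close>

definition g_SO :: "('n::finite) sqmat \<Rightarrow> 'n sqmat \<Rightarrow> 'n sqmat \<Rightarrow> real" where
  "g_SO U A B = - 1/2 * trace ((transpose U ** A) ** (transpose U ** B))"

definition g_D :: "('n::finite) sqmat \<Rightarrow> 'n sqmat \<Rightarrow> 'n sqmat \<Rightarrow> real" where
  "g_D D L1 L2 = trace (matrix_inv D ** L1 ** matrix_inv D ** L2)"

definition g_M :: "real \<Rightarrow> ('n::finite) sqmat \<times> 'n sqmat \<Rightarrow> 'n sqmat \<times> 'n sqmat
    \<Rightarrow> 'n sqmat \<times> 'n sqmat \<Rightarrow> real" where
  "g_M k m a b = k * g_SO (fst m) (fst a) (fst b) + g_D (snd m) (snd a) (snd b)"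

definition d_M :: "real \<Rightarrow> ('n::finite) sqmat \<times> 'n sqmat \<Rightarrow> 'n sqmat \<times> 'n sqmat \<Rightarrow> real" where
  "d_M k = riem_dist (g_M k) Mp"

definition d_SR :: "real \<Rightarrow> ('n::finite) sqmat \<Rightarrow> 'n sqmat \<Rightarrow> real" where
  "d_SR k X Y = Inf {d_M k a b | a b. a \<in> fiber X \<and> b \<in> fiber Y}"

definition F_minimal_geodesic ::
  "real \<Rightarrow> ('n::finite) sqmat \<Rightarrow> 'n sqmat \<Rightarrow> (real \<Rightarrow> 'n sqmat \<times> 'n sqmat) \<Rightarrow> bool" where
  "F_minimal_geodesic k X Y \<gamma> \<longleftrightarrow>
     geodesic_on (g_M k) tangent_M Mp {0..1} \<gamma> \<and> \<gamma> 0 \<in> fiber X \<and> \<gamma> 1 \<in> fiber Y \<and>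
     curve_length (g_M k) \<gamma> = d_SR k X Y"

text \<open>
  The curve \<open>F \<circ> \<gamma>\<close> as a map on \<open>[0,1]\<close>; it is an MSSR curve when \<open>\<gamma>\<close> is an
  \<open>F\<close>-minimal geodesic.
\<close>

definition sr_curve :: "(real \<Rightarrow> ('n::finite) sqmat \<times> 'n sqmat) \<Rightarrow> real \<Rightarrow> 'n sqmat" where
  "sr_curve \<gamma> = restrict (F \<circ> \<gamma>) {0..1}"

definition proj_SO_velocity :: "(real \<Rightarrow> ('n::finite) sqmat \<times> 'n sqmat) \<Rightarrow> 'n sqmat" where
  "proj_SO_velocity \<gamma> = fst (vector_derivative \<gamma> (at 0 within {0..1}))"

text \<open>
  Antipodality is defined by the cut locus. For \<open>p \<ge> 4\<close> this is strictly weaker than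
  \<open>V\<^sup>-\<^sup>1 U\<close> being an involution: every rotation with eigenvalue \<open>-1\<close> is in the cut locus of
  the identity.
\<close>

definition geod_antipodal :: "('n::finite) sqmat \<Rightarrow> 'n sqmat \<Rightarrow> bool" where
  "geod_antipodal U V \<longleftrightarrow>
     U \<in> cut_locus g_SO tangent_SO SO V \<or> V \<in> cut_locus g_SO tangent_SO SO U"


section \<open>Signed permutations and stabilizers\<close>

text \<open>Even signed permutations, identified with their matrices (so \<open>P\<^sub>g\<close> is \<open>g\<close>).\<close>

definition even_signed_perms :: "('n::finite) sqmat set" where
  "even_signed_perms =
     {P \<in> SO. (\<forall>i. \<exists>!j. P $ i $ j \<noteq> 0) \<and> (\<forall>j. \<exists>!i. P $ i $ j \<noteq> 0) \<and>
              (\<forall>i j. P $ i $ j \<in> {0, 1, -1})}"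

text \<open>\<open>P\<^sub>g\<close> maps the \<open>j\<close>-th basis vector to plus or minus the \<open>\<pi>\<^sub>g(j)\<close>-th one.\<close>

definition underlying_perm :: "('n::finite) sqmat \<Rightarrow> 'n \<Rightarrow> 'n" where
  "underlying_perm P j = (THE i. P $ i $ j \<noteq> 0)"

text \<open>The action on diagonal matrices: entry \<open>j\<close> is moved to position \<open>\<pi> j\<close>.\<close>

definition perm_act :: "('n::finite \<Rightarrow> 'n) \<Rightarrow> 'n sqmat \<Rightarrow> 'n sqmat" where
  "perm_act \<pi> D = (\<chi> i j. D $ (inv \<pi> i) $ (inv \<pi> j))"

lemma perm_act_eq_conj:
  assumes "P \<in> even_signed_perms" "diagonal_mat D"
  shows "perm_act (underlying_perm P) D = P ** D ** matrix_inv P"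
proof -
  let ?p = "underlying_perm P"
  have ex1: "\<exists>!i. P $ i $ j \<noteq> 0" and ex2: "\<exists>!i. P $ j $ i \<noteq> 0"
    and val: "P $ i $ j \<in> {0, 1, -1}" for i j
    using assms(1) by (auto simp: even_signed_perms_def)
  have nz: "P $ i $ j \<noteq> 0 \<longleftrightarrow> i = ?p j" for i j
    unfolding underlying_perm_def using theI'[OF ex1[of j]] ex1[of j] by blast
  have "inj ?p"
    by (rule injI) (metis nz ex2)
  then have bij: "bij ?p"
    by (simp add: finite_UNIV_inj_surj bij_def)
  have orth: "orthogonal_matrix P"
    using assms(1) by (auto simp: even_signed_perms_def SO_def rotation_matrix_def)
  have inv: "matrix_inv P = transpose P"
  proof -
    have PT: "P ** transpose P = mat 1" "transpose P ** P = mat 1"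
      using orth by (auto simp: orthogonal_matrix_def)
    have "P ** matrix_inv P = mat 1 \<and> matrix_inv P ** P = mat 1"
      unfolding matrix_inv_def by (rule someI[of _ "transpose P"]) (use PT in auto)
    then have "matrix_inv P = (transpose P ** P) ** matrix_inv P" "P ** matrix_inv P = mat 1"
      using PT by simp_all
    then show ?thesis
      by (simp add: matrix_mul_assoc[symmetric])
  qed
  have sq: "P $ ?p j $ j * P $ ?p j $ j = 1" for j
    using val[of "?p j" j] nz[of "?p j" j] by auto
  have PD: "(P ** D) $ i $ j = P $ i $ j * D $ j $ j" for i j
  proof -
    have "(P ** D) $ i $ j = (\<Sum>k\<in>UNIV. P $ i $ k * D $ k $ j)"
      by (simp add: matrix_matrix_mult_def)
    also have "\<dots> = (\<Sum>k\<in>UNIV. if k = j then P $ i $ j * D $ j $ j else 0)"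
      by (rule sum.cong) (use assms(2) in \<open>auto simp: diagonal_mat_def\<close>)
    finally show ?thesis by simp
  qed
  have "(P ** D ** transpose P) $ i $ j = D $ (inv ?p i) $ (inv ?p j)" for i j
  proof -
    have *: "P $ i $ k \<noteq> 0 \<longleftrightarrow> k = inv ?p i" for i k
      using nz bij by (metis bij_inv_eq_iff)
    have "(P ** D ** transpose P) $ i $ j = (\<Sum>k\<in>UNIV. P $ i $ k * D $ k $ k * P $ j $ k)"
      by (subst matrix_matrix_mult_def) (simp add: PD transpose_def)
    also have "\<dots> = (\<Sum>k\<in>UNIV. if k = inv ?p i then P $ i $ k * D $ k $ k * P $ j $ k else 0)"
      using * by (intro sum.cong) auto
    also have "\<dots> = P $ i $ (inv ?p i) * D $ (inv ?p i) $ (inv ?p i) * P $ j $ (inv ?p i)"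
      by simp
    also have "\<dots> = D $ (inv ?p i) $ (inv ?p j)"
    proof (cases "i = j")
      case True
      then show ?thesis
        using sq[of "inv ?p i"] bij by (simp add: bij_is_surj surj_f_inv_f mult.commute)
    next
      case False
      then have ne: "inv ?p i \<noteq> inv ?p j"
        using bij by (metis bij_is_surj surj_f_inv_f)
      then have "P $ j $ (inv ?p i) = 0" using * by blast
      then show ?thesis using ne assms(2) by (simp add: diagonal_mat_def)
    qed
    finally show ?thesis .
  qed
  then show ?thesis
    by (simp add: inv perm_act_def vec_eq_iff)
qed

definition stab :: "('n::finite) sqmat \<Rightarrow> 'n sqmat set" where
  "stab D = {R \<in> SO. R ** D ** transpose R = D}"

definition stab2 :: "('n::finite) sqmat \<Rightarrow> 'n sqmat \<Rightarrow> 'n sqmat set" where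
  "stab2 D L = stab D \<inter> stab L"

definition identity_component :: "('n::finite) sqmat set \<Rightarrow> 'n sqmat set" where
  "identity_component H = connected_component_set H (mat 1)"

end

theory Submission
  imports Defs
begin

text \<open>
  Put \<open>U\<^sub>i = U RU\<^sub>i\<close>. The geodesic equation on \<open>M(p)\<close> integrates explicitly: there are a
  skew-symmetric matrix \<open>A\<^sub>i\<close> and a vector \<open>l\<^sub>i\<close> with
  \<open>\<gamma>\<^sub>i(t) = (exp(t A\<^sub>i) U\<^sub>i, \<delta>\<^sub>i(t))\<close>, where \<open>\<delta>\<^sub>i(t)\<close> is diagonal with entries
  \<open>a\<^sub>j exp(t l\<^sub>i\<^sub>j)\<close> and \<open>a\<close> is the diagonal of \<open>D\<close> (\<open>geodesic_M_form\<close>). In these terms the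
  equation between velocities in the theorem says \<open>A\<^sub>1 = A\<^sub>2\<close>, and the equation between endpoints
  says \<open>exp A\<^sub>1 = exp A\<^sub>2\<close>, so the first implies the second. The rest of the theorem comes from the following facts.

  If the curves agree then \<open>A\<^sub>1 = A\<^sub>2\<close> (\<open>minimal_arcs_velocity_eq\<close>). The derivative of
  \<open>F \<circ> \<gamma>\<^sub>i\<close> at \<open>0\<close> is \<open>[A\<^sub>i, X]\<close> plus a matrix that commutes with \<open>X\<close>. The image of \<open>[\<cdot>, X]\<close> is
  orthogonal to the commutant of \<open>X\<close>, so \<open>A\<^sub>1 - A\<^sub>2\<close> commutes with \<open>X\<close>. But minimality makes \<open>A\<^sub>i\<close>
  orthogonal to every skew-symmetric matrix commuting with \<open>X\<close>, because such a matrix generates a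
  motion of the starting point inside the fiber over \<open>X\<close> (\<open>minimal_arc_orthogonal\<close>). Hence
  \<open>A\<^sub>1 - A\<^sub>2\<close> is orthogonal to itself.

  If \<open>A\<^sub>1 = A\<^sub>2\<close>, then the common factor \<open>exp(t A\<^sub>1)\<close> cancels, and the curves agree if and only if
  \<open>Q = U\<^sub>1\<^sup>T U\<^sub>2\<close> satisfies \<open>Q \<delta>\<^sub>2(t) = \<delta>\<^sub>1(t) Q\<close> for all \<open>t\<close>, which only has to be tested at
  \<open>t = 0\<close> and \<open>t = 1\<close> (\<open>intertwines_scaling\<close>). Such \<open>Q\<close> are exactly the products \<open>R P\<^sub>h\<^sup>-\<^sup>1\<close> of the
  second condition (\<open>intertwiner_factorization\<close>): a nonzero term of the Leibniz expansion of
  \<open>det Q\<close> supplies the permutation, and the signs are chosen to reach the identity component of the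
  stabilizer (\<open>sign_correction\<close>).

  If \<open>exp A\<^sub>1 = exp A\<^sub>2\<close> and the pairs are not antipodal, then \<open>A\<^sub>1 = A\<^sub>2\<close>
  (\<open>nonantipodal_velocity_eq\<close>). The rotational part of \<open>\<gamma>\<^sub>i\<close> is itself shortest among all paths
  in \<open>SO(p)\<close> (\<open>SO_part_minimal\<close>). So if \<open>A\<^sub>1 \<noteq> A\<^sub>2\<close>, two shortest geodesics with different
  directions join the same points; prolonging one of them beyond the common endpoint gives a corner,
  which can be shortened, so that the endpoint is a cut point (\<open>cut_locus_two_minimal\<close>). The
  shortcut comes from one computation: the path \<open>s \<mapsto> exp(s A) exp(s B) U\<close> has constant speed
  \<open>|A + B|\<close>, with the norm given by the metric (\<open>two_mexp_path\<close>).

  Antipodality of a pair does not change under right translation, and \<open>exp A\<^sub>1 = exp A\<^sub>2\<close> makes the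
  two pairs right translates of each other; so they are antipodal together or not at all.
\<close>

section \<open>Matrix algebra and the rotation group\<close>

interpretation matrix_mult: bounded_bilinear "(**) :: real^'n^'m \<Rightarrow> real^'k^'n \<Rightarrow> real^'k^'m"
proof -
  have "bilinear ((**) :: real^'n^'m \<Rightarrow> real^'k^'n \<Rightarrow> real^'k^'m)"
    by (auto simp: bilinear_def matrix_matrix_mult_def vec_eq_iff sum.distrib sum_distrib_left
        algebra_simps intro!: linearI)
  then show "bounded_bilinear ((**) :: real^'n^'m \<Rightarrow> real^'k^'n \<Rightarrow> real^'k^'m)"
    by (simp add: bilinear_conv_bounded_bilinear)
qed

lemma bounded_linear_transpose: "bounded_linear (transpose :: real^'n^'m \<Rightarrow> real^'m^'n)"
  by (rule linear_conv_bounded_linear[THEN iffD1], rule linearI)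
     (auto simp: transpose_def vec_eq_iff)

lemma transpose_linear_simps:
  fixes A B :: "real^'n^'m"
  shows "transpose (A + B) = transpose A + transpose B" "transpose (A - B) = transpose A - transpose B"
    "transpose (- A) = - transpose A" "transpose (c *\<^sub>R A) = c *\<^sub>R transpose A"
    "transpose (0 :: real^'n^'m) = 0"
  by (simp_all add: transpose_def vec_eq_iff)

lemmas mat_distrib = matrix_mult.add_left matrix_mult.add_right matrix_mult.diff_left matrix_mult.diff_right
  matrix_mult.minus_left matrix_mult.minus_right matrix_mult.scaleR_left matrix_mult.scaleR_right
  matrix_mult.zero_left matrix_mult.zero_right matrix_transpose_mul transpose_linear_simps

lemma trace_transpose: "trace (transpose A) = trace A"
  by (simp add: trace_def transpose_def)

lemma trace_minus: "trace (- A :: real^'n^'n) = - trace A"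
  by (simp add: trace_def sum_negf)

lemma trace_scaleR: "trace (c *\<^sub>R A :: real^'n^'n) = c * trace A"
  by (simp add: trace_def sum_distrib_left)

text \<open>
  The inner product of the type of matrices is the Frobenius product, which makes it and the norm
  invariant under multiplication by rotations on either side.
\<close>

lemma inner_eq_trace: "A \<bullet> B = trace (transpose A ** (B :: real^'n^'n))"
proof -
  have "A \<bullet> B = (\<Sum>i\<in>UNIV. \<Sum>j\<in>UNIV. A $ i $ j * B $ i $ j)"
    by (simp add: inner_vec_def)
  also have "\<dots> = trace (transpose A ** B)"
    by (subst sum.swap) (simp add: trace_def matrix_matrix_mult_def transpose_def)
  finally show ?thesis .
qed

lemma inner_transpose: "transpose A \<bullet> transpose B = A \<bullet> (B :: real^'n^'n)"
  using trace_mul_sym[of A "transpose B"] trace_transpose[of "transpose B ** A"]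
  by (simp add: inner_eq_trace matrix_transpose_mul)

lemma SO_D:
  assumes "U \<in> SO"
  shows "transpose U ** U = mat 1" "U ** transpose U = mat 1" "det U = 1"
    "transpose U ** (U ** B) = B" "U ** (transpose U ** B) = B"
  using assms
  by (auto simp: SO_def rotation_matrix_def orthogonal_matrix_def matrix_mul_assoc)

lemma SO_I: "transpose U ** U = mat 1 \<Longrightarrow> det U = 1 \<Longrightarrow> U \<in> SO"
  by (simp add: SO_def rotation_matrix_def orthogonal_matrix)

lemma SO_mult: "U \<in> SO \<Longrightarrow> V \<in> SO \<Longrightarrow> U ** V \<in> SO"
  by (intro SO_I) (simp_all add: det_mul SO_D matrix_transpose_mul flip: matrix_mul_assoc)

lemma SO_transpose: "U \<in> SO \<Longrightarrow> transpose U \<in> SO"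
  by (simp add: SO_def rotation_matrix_def)

lemma SO_one: "mat 1 \<in> SO"
  by (intro SO_I) simp_all

lemma matrix_inv_orthogonal:
  fixes P :: "real^'n^'n"
  assumes "transpose P ** P = mat 1"
  shows "matrix_inv P = transpose P"
proof -
  have PT: "P ** transpose P = mat 1"
    using assms matrix_left_right_inverse by blast
  have "P ** matrix_inv P = mat 1 \<and> matrix_inv P ** P = mat 1"
    unfolding matrix_inv_def by (rule someI[of _ "transpose P"]) (use PT assms in auto)
  then have "(transpose P ** P) ** matrix_inv P = transpose P"
    by (simp flip: matrix_mul_assoc)
  then show ?thesis using assms by simp
qed

lemma SO_inv: "U \<in> SO \<Longrightarrow> matrix_inv U = transpose U"
  by (simp add: SO_D matrix_inv_orthogonal)

lemma inner_SO_left: 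
  fixes A B U :: "real^'n^'n"
  shows "U \<in> SO \<Longrightarrow> (U ** A) \<bullet> (U ** B) = A \<bullet> B"
  by (simp add: inner_eq_trace matrix_transpose_mul SO_D flip: matrix_mul_assoc)

lemma inner_SO_right: 
  fixes A B U :: "real^'n^'n"
  shows "U \<in> SO \<Longrightarrow> (A ** U) \<bullet> (B ** U) = A \<bullet> B"
  by (metis SO_transpose inner_SO_left inner_transpose matrix_transpose_mul)

lemma norm_SO_left: 
  fixes A U :: "real^'n^'n"
  shows "U \<in> SO \<Longrightarrow> norm (U ** A) = norm A"
  by (simp add: norm_eq_sqrt_inner inner_SO_left)

lemma norm_SO_right: 
  fixes A U :: "real^'n^'n"
  shows "U \<in> SO \<Longrightarrow> norm (A ** U) = norm A"
  by (simp add: norm_eq_sqrt_inner inner_SO_right)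

lemma bounded_linear_trace: "bounded_linear (trace :: real^'n^'n \<Rightarrow> real)"
  by (rule linear_conv_bounded_linear[THEN iffD1], rule linearI)
     (auto simp: trace_add trace_scaleR)

text \<open>
  Twice the trace in the hypothesis is the squared norm of \<open>S - S\<^sup>T\<close>. A stationarity condition tested
  against skew-symmetric directions therefore yields symmetry.
\<close>

lemma symmetricI_trace:
  assumes "trace (S ** (transpose S - S)) = 0"
  shows "transpose S = (S :: real^'n^'n)"
proof -
  have 1: "trace (transpose S ** transpose S) = trace (S ** S)"
    by (metis matrix_transpose_mul trace_transpose)
  have 2: "trace (transpose S ** S) = trace (S ** transpose S)"
    by (rule trace_mul_sym)
  have "(S - transpose S) \<bullet> (S - transpose S) = 2 * trace (S ** (transpose S - S))"
    by (simp add: inner_eq_trace mat_distrib trace_sub trace_add 1 2)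
  then show ?thesis using assms by simp
qed

section \<open>Exponentials of skew-symmetric matrices\<close>

definition skew :: "real^'n^'n \<Rightarrow> bool" where
  "skew A \<longleftrightarrow> transpose A = - A"

lemma skew_intros:
  "skew A \<Longrightarrow> skew B \<Longrightarrow> skew (A + B)" "skew A \<Longrightarrow> skew B \<Longrightarrow> skew (A - B)"
  "skew A \<Longrightarrow> skew (c *\<^sub>R A)" "skew A \<Longrightarrow> skew (- A)" "skew 0"
  by (simp_all add: skew_def mat_distrib)

lemma trace_symmetric_skew:
  assumes "transpose S = S" "skew B"
  shows "trace (S ** B) = 0" "trace (B ** S) = 0"
proof -
  have "trace (S ** B) = trace (transpose (S ** B))" by (simp add: trace_transpose)
  also have "\<dots> = - trace (B ** S)"
    using assms by (simp add: mat_distrib skew_def trace_minus)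
  also have "\<dots> = - trace (S ** B)" by (simp only: trace_mul_sym[of B S])
  finally show "trace (S ** B) = 0" by simp
  then show "trace (B ** S) = 0" by (simp only: trace_mul_sym[of B S])
qed

text \<open>
  The matrix exponential \<open>exp(t A)\<close>, as an entrywise power series in \<open>t\<close>. Under the Frobenius norm of
  the matrix type the unit in general does not have norm \<open>1\<close>, so the exponential of Banach algebras does not apply.
\<close>

definition mexp :: "real^'n^'n \<Rightarrow> real \<Rightarrow> real^'n^'n" where
  "mexp A t = (\<chi> i j. \<Sum>n. ((((**) A ^^ n) (mat 1)) $ i $ j / fact n) * t ^ n)"

lemma mexp_0: "mexp A 0 = mat 1"
proof -
  have "(\<Sum>n. ((((**) A ^^ n) (mat 1)) $ i $ j / fact n) * 0 ^ n) = mat 1 $ i $ j" for i j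
    using powser_zero[of "\<lambda>n. (((**) A ^^ n) (mat 1)) $ i $ j / fact n"] by simp
  then show ?thesis by (simp add: mexp_def vec_eq_iff)
qed

lemma mexp_deriv: "(mexp A has_vector_derivative A ** mexp A t) (at t within S)"
proof -
  define P where "P n = ((**) A ^^ n) (mat 1)" for n
  define K where "K = (\<Sum>i\<in>UNIV. \<Sum>k\<in>UNIV. \<bar>A $ i $ k\<bar>)"
  have P_Suc: "P (Suc n) $ i $ j = (\<Sum>k\<in>UNIV. A $ i $ k * P n $ k $ j)" for n i j
    by (simp add: P_def matrix_matrix_mult_def)
  have row: "(\<Sum>k\<in>UNIV. \<bar>A $ i $ k\<bar>) \<le> K" for i
    unfolding K_def by (rule member_le_sum) (auto intro: sum_nonneg)
  have K0: "0 \<le> K" by (simp add: K_def sum_nonneg)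
  have bound: "\<bar>P n $ i $ j\<bar> \<le> K ^ n" for n i j
  proof (induction n arbitrary: i)
    case 0
    show ?case by (simp add: P_def mat_def)
  next
    case (Suc n)
    have "\<bar>P (Suc n) $ i $ j\<bar> \<le> (\<Sum>k\<in>UNIV. \<bar>A $ i $ k * P n $ k $ j\<bar>)"
      unfolding P_Suc by (rule sum_abs)
    also have "\<dots> \<le> (\<Sum>k\<in>UNIV. \<bar>A $ i $ k\<bar> * K ^ n)"
      by (intro sum_mono) (simp add: abs_mult Suc mult_left_mono)
    also have "\<dots> \<le> K * K ^ n"
      using row[of i] K0 by (simp add: mult_right_mono flip: sum_distrib_right)
    finally show ?case by simp
  qed
  have summ: "summable (\<lambda>n. (P n $ i $ j / fact n) * y ^ n)" for i j and y :: real
  proof (rule summable_comparison_test')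
    show "summable (\<lambda>n. inverse (fact n) * (K * \<bar>y\<bar>) ^ n)"
      by (rule summable_exp)
    show "norm ((P n $ i $ j / fact n) * y ^ n) \<le> inverse (fact n) * (K * \<bar>y\<bar>) ^ n"
      if "n \<ge> 0" for n
    proof -
      have "norm ((P n $ i $ j / fact n) * y ^ n) = (\<bar>P n $ i $ j\<bar> * \<bar>y\<bar> ^ n) / fact n"
        by (simp add: abs_mult power_abs)
      also have "\<dots> \<le> (K ^ n * \<bar>y\<bar> ^ n) / fact n"
        by (intro divide_right_mono mult_right_mono bound) auto
      also have "\<dots> = inverse (fact n) * (K * \<bar>y\<bar>) ^ n"
        by (simp add: power_mult_distrib divide_inverse mult.commute)
      finally show ?thesis .
    qed
  qed
  have dif: "diffs (\<lambda>n. P n $ i $ j / fact n) n = (\<Sum>k\<in>UNIV. A $ i $ k * (P n $ k $ j / fact n))"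
    for i j n
    by (simp add: diffs_def P_Suc divide_simps sum_distrib_left sum_divide_distrib)
  have entry: "((\<lambda>t. mexp A t $ i $ j) has_vector_derivative (A ** mexp A t) $ i $ j) (at t within S)"
    for i j
  proof -
    have "((\<lambda>x. \<Sum>n. (P n $ i $ j / fact n) * x ^ n) has_field_derivative
        (\<Sum>n. diffs (\<lambda>n. P n $ i $ j / fact n) n * t ^ n)) (at t)"
      by (rule termdiffs_strong_converges_everywhere) (rule summ)
    moreover have "(\<Sum>n. diffs (\<lambda>n. P n $ i $ j / fact n) n * t ^ n)
        = (\<Sum>k\<in>UNIV. A $ i $ k * (\<Sum>n. (P n $ k $ j / fact n) * t ^ n))"
    proof -
      have "(\<Sum>n. diffs (\<lambda>n. P n $ i $ j / fact n) n * t ^ n)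
          = (\<Sum>n. \<Sum>k\<in>UNIV. A $ i $ k * ((P n $ k $ j / fact n) * t ^ n))"
        by (simp add: dif sum_distrib_right mult.assoc)
      also have "\<dots> = (\<Sum>k\<in>UNIV. \<Sum>n. A $ i $ k * ((P n $ k $ j / fact n) * t ^ n))"
        by (rule suminf_sum) (intro summable_mult summ)
      also have "\<dots> = (\<Sum>k\<in>UNIV. A $ i $ k * (\<Sum>n. (P n $ k $ j / fact n) * t ^ n))"
        by (intro sum.cong refl suminf_mult summ)
      finally show ?thesis .
    qed
    ultimately have "((\<lambda>t. mexp A t $ i $ j) has_field_derivative (A ** mexp A t) $ i $ j) (at t)"
      by (simp add: mexp_def P_def matrix_matrix_mult_def)
    then show ?thesis
      by (simp add: has_field_derivative_at_within has_real_derivative_iff_has_vector_derivative[symmetric])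
  qed
  then show ?thesis
    unfolding has_vector_derivative_def
    by (subst has_derivative_componentwise_within)
       (auto simp: Basis_vec_def inner_axis has_vector_derivative_def)
qed


lemma has_vector_derivative_zero_eq:
  assumes "convex S" "0 \<in> S" "t \<in> S"
    and "\<And>t. t \<in> S \<Longrightarrow> (f has_vector_derivative 0) (at t within S)"
  shows "f t = f (0 :: real)"
  by (rule has_derivative_zero_unique[OF assms(1) _ assms(3,2)]) (use assms(4) in \<open>simp add: has_vector_derivative_def\<close>)

lemma mexp_deriv_comp:
  assumes "(f has_real_derivative f') (at t within S)"
  shows "((\<lambda>t. mexp A (f t)) has_vector_derivative f' *\<^sub>R (A ** mexp A (f t))) (at t within S)"
  using vector_diff_chain_within[OF _ mexp_deriv, of f f' t S A] assms
  by (simp add: o_def has_real_derivative_iff_has_vector_derivative)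

lemma mexp_orthogonal:
  assumes "skew A"
  shows "transpose (mexp A t) ** mexp A t = mat 1"
proof -
  have "((\<lambda>t. transpose (mexp A t) ** mexp A t) has_vector_derivative 0) (at t within UNIV)" for t
  proof -
    have "((\<lambda>t. transpose (mexp A t) ** mexp A t) has_vector_derivative
       transpose (mexp A t) ** (A ** mexp A t) + transpose (A ** mexp A t) ** mexp A t) (at t within UNIV)"
      by (intro matrix_mult.has_vector_derivative mexp_deriv
          bounded_linear.has_vector_derivative[OF bounded_linear_transpose])
    then show ?thesis
      using assms by (simp add: mat_distrib skew_def matrix_mul_assoc)
  qed
  then have "transpose (mexp A t) ** mexp A t = transpose (mexp A 0) ** mexp A 0"
    by (intro has_vector_derivative_zero_eq[of UNIV]) auto
  then show ?thesis by (simp add: mexp_0)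
qed

text \<open>
  For skew-symmetric \<open>A\<close> the product \<open>exp(t A)\<^sup>T W(t)\<close> is constant. Uniqueness for \<open>W' = A W\<close> then
  gives all algebraic properties of the exponential that are used: the group law, and commutation
  with everything that commutes with \<open>A\<close>.
\<close>

lemma mexp_unique:
  assumes "skew A" "convex S" "0 \<in> S" "t \<in> S"
    and W: "\<And>t. t \<in> S \<Longrightarrow> (W has_vector_derivative A ** W t) (at t within S)"
  shows "W t = mexp A t ** W 0"
proof -
  have "((\<lambda>t. transpose (mexp A t) ** W t) has_vector_derivative 0) (at t within S)"
    if "t \<in> S" for t
  proof -
    have "((\<lambda>t. transpose (mexp A t) ** W t) has_vector_derivative
       transpose (mexp A t) ** (A ** W t) + transpose (A ** mexp A t) ** W t) (at t within S)"
      by (intro matrix_mult.has_vector_derivative mexp_deriv W that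
          bounded_linear.has_vector_derivative[OF bounded_linear_transpose])
    then show ?thesis
      using assms(1) by (simp add: mat_distrib skew_def matrix_mul_assoc)
  qed
  then have c: "transpose (mexp A t) ** W t = transpose (mexp A 0) ** W 0"
    by (rule has_vector_derivative_zero_eq[OF assms(2-4)])
  have "mexp A t ** transpose (mexp A t) = mat 1"
    using mexp_orthogonal[OF assms(1)] matrix_left_right_inverse by blast
  then have "W t = mexp A t ** (transpose (mexp A t) ** W t)"
    by (simp add: matrix_mul_assoc)
  then show ?thesis by (simp add: c mexp_0)
qed

lemma mexp_commute:
  fixes B :: "real^'n^'n"
  assumes "skew A" "A ** B = B ** A"
  shows "mexp A t ** B = B ** mexp A t"
proof -
  have "((\<lambda>t. B ** mexp A t) has_vector_derivative A ** (B ** mexp A t)) (at t within UNIV)" for t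
    using matrix_mult.has_vector_derivative[OF has_vector_derivative_const mexp_deriv, of B A t UNIV] assms(2)
    by (simp add: mat_distrib matrix_mul_assoc)
  then show ?thesis
    using mexp_unique[of A UNIV t "\<lambda>t. B ** mexp A t"] assms(1) by (simp add: mexp_0)
qed

lemma mexp_add:
  assumes "skew A"
  shows "mexp A (s + t) = mexp A s ** mexp A t"
proof -
  have "((\<lambda>s. mexp A (s + t)) has_vector_derivative A ** mexp A (s + t)) (at s within UNIV)" for s
  proof -
    have "((\<lambda>s. s + t) has_real_derivative 1) (at s)"
      by (auto intro!: derivative_eq_intros)
    from mexp_deriv_comp[OF this, of A] show ?thesis by simp
  qed
  then show ?thesis
    using mexp_unique[of A UNIV s "\<lambda>s. mexp A (s + t)"] assms(1) by simp
qed

lemma mexp_scaleR: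
  assumes "skew A"
  shows "mexp (c *\<^sub>R A) t = mexp A (c * t)"
proof -
  have "((\<lambda>t. mexp A (c * t)) has_vector_derivative (c *\<^sub>R A) ** mexp A (c * t)) (at t within UNIV)" for t
    using mexp_deriv_comp[of "\<lambda>t. c * t" c t UNIV A]
    by (auto intro!: derivative_eq_intros simp: mat_distrib)
  then show ?thesis
    using mexp_unique[of "c *\<^sub>R A" UNIV t "\<lambda>t. mexp A (c * t)"] assms(1)
    by (simp add: mexp_0 skew_intros)
qed

text \<open>
  The determinant is \<open>\<plusminus>1\<close> by orthogonality, and it is a square because \<open>exp(t A) = exp(t/2 A)\<^sup>2\<close>.
\<close>

lemma mexp_SO:
  assumes "skew A"
  shows "mexp A t \<in> SO"
proof (rule SO_I)
  show "transpose (mexp A t) ** mexp A t = mat 1"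
    by (rule mexp_orthogonal[OF assms])
  then have "det (mexp A t) = 1 \<or> det (mexp A t) = -1"
    by (simp add: det_orthogonal_matrix orthogonal_matrix)
  moreover have "det (mexp A t) = det (mexp A (t/2)) * det (mexp A (t/2))"
    using mexp_add[OF assms, of "t/2" "t/2"] by (simp add: det_mul)
  ultimately show "det (mexp A t) = 1"
    by (metis zero_le_square not_one_le_zero neg_0_le_iff_le)
qed

lemma mexp_cancel: "skew A \<Longrightarrow> mexp A (- t) ** mexp A t = mat 1"
  using mexp_add[of A "- t" t] by (simp add: mexp_0)

section \<open>Diagonal matrices\<close>

definition diagm :: "real^'n \<Rightarrow> real^'n^'n" where
  "diagm a = (\<chi> i j. if i = j then a $ i else 0)"

lemma diagm_nth: "diagm a $ i $ j = (if i = j then a $ i else 0)"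
  by (simp add: diagm_def)

lemma diagonal_diagm: "diagonal_mat (diagm a)"
  by (simp add: diagonal_mat_def diagm_nth)

lemma diagonal_eq_diagm: "diagonal_mat D \<Longrightarrow> D = diagm (\<chi> i. D $ i $ i)"
  by (auto simp: diagonal_mat_def diagm_def vec_eq_iff)

lemma diagonal_mat_iff: "diagonal_mat D \<longleftrightarrow> (\<exists>a. D = diagm a)"
  using diagonal_eq_diagm diagonal_diagm by blast

lemma diagm_mult_left: "(diagm a ** B) $ i $ j = a $ i * B $ i $ j"
proof -
  have "(diagm a ** B) $ i $ j = (\<Sum>k\<in>UNIV. diagm a $ i $ k * B $ k $ j)"
    by (simp add: matrix_matrix_mult_def)
  also have "\<dots> = (\<Sum>k\<in>UNIV. if k = i then a $ i * B $ i $ j else 0)"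
    by (rule sum.cong) (auto simp: diagm_nth)
  finally show ?thesis by simp
qed

lemma diagm_mult_right: "(B ** diagm a) $ i $ j = B $ i $ j * a $ j"
proof -
  have "(B ** diagm a) $ i $ j = (\<Sum>k\<in>UNIV. B $ i $ k * diagm a $ k $ j)"
    by (simp add: matrix_matrix_mult_def)
  also have "\<dots> = (\<Sum>k\<in>UNIV. if k = j then B $ i $ j * a $ j else 0)"
    by (rule sum.cong) (auto simp: diagm_nth)
  finally show ?thesis by simp
qed

lemma diagm_mult: "diagm a ** diagm b = diagm (\<chi> i. a $ i * b $ i)"
  by (auto simp: vec_eq_iff diagm_mult_left diagm_nth)

lemma trace_diagm: "trace (diagm a) = (\<Sum>i\<in>UNIV. a $ i)"
  by (simp add: trace_def diagm_nth)

lemma transpose_diagm: "transpose (diagm a) = diagm a"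
  by (auto simp: vec_eq_iff diagm_nth transpose_def)

lemma matrix_inv_diagm:
  assumes "\<And>i. a $ i \<noteq> 0"
  shows "matrix_inv (diagm a) = diagm (\<chi> i. inverse (a $ i))"
proof -
  let ?b = "diagm (\<chi> i. inverse (a $ i))"
  have 1: "diagm a ** ?b = mat 1" "?b ** diagm a = mat 1"
    using assms by (auto simp: diagm_mult vec_eq_iff diagm_nth mat_def)
  have "diagm a ** matrix_inv (diagm a) = mat 1 \<and> matrix_inv (diagm a) ** diagm a = mat 1"
    unfolding matrix_inv_def by (rule someI[of _ ?b]) (use 1 in auto)
  then have "(?b ** diagm a) ** matrix_inv (diagm a) = ?b"
    by (simp flip: matrix_mul_assoc)
  then show ?thesis using 1 by simp
qed

lemma g_D_diagm:
  assumes "\<And>i. a $ i \<noteq> 0"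
  shows "g_D (diagm a) (diagm b) (diagm c) = (\<Sum>i\<in>UNIV. b $ i * c $ i / (a $ i)\<^sup>2)"
  using assms
  by (simp add: g_D_def matrix_inv_diagm diagm_mult trace_diagm field_simps power2_eq_square)

lemma DiagP_diagm: "diagm a \<in> DiagP \<longleftrightarrow> (\<forall>i. 0 < a $ i)"
  by (simp add: DiagP_def diagonal_diagm diagm_nth)

lemma DiagP_obtain:
  assumes "D \<in> DiagP"
  obtains a where "D = diagm a" "\<And>i. 0 < a $ i"
  using assms diagonal_eq_diagm[of D] by (force simp: DiagP_def)

section \<open>The metric on tangent vectors\<close>

text \<open>
  On tangent vectors \<open>g_SO\<close> is half the Frobenius product, so lengths in \<open>SO(p)\<close> are Euclidean
  lengths of matrices divided by \<open>sqrt 2\<close>.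
\<close>

lemma g_SO_tangent:
  assumes "U \<in> SO" "A \<in> tangent_SO U"
  shows "g_SO U A B = (A \<bullet> B) / 2"
proof -
  have "(transpose U ** A) \<bullet> (transpose U ** B) = A \<bullet> B"
    by (rule inner_SO_left[OF SO_transpose[OF assms(1)]])
  then have "trace ((- (transpose U ** A)) ** (transpose U ** B)) = A \<bullet> B"
    using assms(2) unfolding inner_eq_trace tangent_SO_def by simp
  then show ?thesis
    by (simp add: g_SO_def mat_distrib trace_minus)
qed

lemma g_SO_norm:
  assumes "U \<in> SO" "A \<in> tangent_SO U"
  shows "g_SO U A A = (norm A / sqrt 2)\<^sup>2"
  by (simp add: g_SO_tangent[OF assms] power_divide flip: power2_norm_eq_inner)

lemma tangent_SO_I:
  assumes "U \<in> SO" "skew A"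
  shows "A ** U \<in> tangent_SO U"
  using assms by (simp add: tangent_SO_def skew_def mat_distrib matrix_mul_assoc)

lemma tangent_SO_of_skew:
  assumes "skew (transpose U ** A)"
  shows "A \<in> tangent_SO U"
  using assms by (simp add: tangent_SO_def skew_def)

lemma has_vector_derivative_entry:
  fixes W :: "real \<Rightarrow> real^'n^'m"
  assumes "(W has_vector_derivative v) net"
  shows "((\<lambda>s. W s $ i $ j) has_vector_derivative v $ i $ j) net"
  by (rule bounded_linear.has_vector_derivative[OF
        bounded_linear_compose[OF bounded_linear_vec_nth bounded_linear_vec_nth] assms])

lemma tangent_SO_derivative:
  assumes t: "t \<in> T" "at t within T \<noteq> bot" and W: "\<And>s. s \<in> T \<Longrightarrow> W s \<in> SO"
    and d: "(W has_vector_derivative v) (at t within T)"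
  shows "v \<in> tangent_SO (W t)"
proof -
  have "((\<lambda>s. transpose (W s) ** W s) has_vector_derivative
      transpose (W t) ** v + transpose v ** W t) (at t within T)"
    by (intro matrix_mult.has_vector_derivative d bounded_linear.has_vector_derivative[OF bounded_linear_transpose])
  moreover have "((\<lambda>s. transpose (W s) ** W s) has_vector_derivative 0) (at t within T)"
    by (rule has_vector_derivative_transform[OF t(1) _ has_vector_derivative_const[of "mat 1"]])
       (simp add: SO_D W)
  ultimately have "transpose (W t) ** v + transpose v ** W t = 0"
    using vector_derivative_unique_within[OF t(2)] by blast
  then show ?thesis
    by (simp add: tangent_SO_def matrix_transpose_mul eq_neg_iff_add_eq_0 add.commute)
qed

lemma diagonal_derivative:
  assumes t: "t \<in> T" "at t within T \<noteq> bot" and W: "\<And>s. s \<in> T \<Longrightarrow> diagonal_mat (W s)"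
    and d: "(W has_vector_derivative v) (at t within T)"
  shows "diagonal_mat v"
  unfolding diagonal_mat_def
proof (intro allI impI)
  fix i j :: 'a assume "i \<noteq> j"
  then have "((\<lambda>s. W s $ i $ j) has_vector_derivative 0) (at t within T)"
    by (intro has_vector_derivative_transform[OF t(1) _ has_vector_derivative_const[of 0]])
       (use W in \<open>auto simp: diagonal_mat_def\<close>)
  then show "v $ i $ j = 0"
    using vector_derivative_unique_within[OF t(2)] has_vector_derivative_entry[OF d] by blast
qed

section \<open>Lengths of piecewise smooth paths\<close>

text \<open>
  The paths over which \<^const>\<open>riem_dist\<close> takes its infimum.
\<close>

definition admissible ::
  "('a::real_normed_vector \<Rightarrow> 'a \<Rightarrow> 'a \<Rightarrow> real) \<Rightarrow> 'a set \<Rightarrow> 'a \<Rightarrow> 'a \<Rightarrow> (real \<Rightarrow> 'a) \<Rightarrow> bool" where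
  "admissible G N a b c \<longleftrightarrow> valid_path c \<and> path_image c \<subseteq> N \<and> speed G c integrable_on {0..1} \<and>
     pathstart c = a \<and> pathfinish c = b"

lemma riem_dist_admissible: "riem_dist G N a b = Inf {curve_length G c | c. admissible G N a b c}"
  by (simp add: riem_dist_def admissible_def)

lemma speed_at:
  assumes "t \<in> {0..1}" "(c has_vector_derivative v) (at t within {0..1})"
  shows "speed G c t = sqrt (G (c t) v v)"
  using vector_derivative_within_cbox[of 0 1 t c v] assms by (simp add: speed_def)

lemma admissible_constant_speed:
  assumes d: "\<And>t. t \<in> {0..1} \<Longrightarrow> (c has_vector_derivative c' t) (at t)"
    and c': "continuous_on {0..1} c'" and N: "\<And>t. t \<in> {0..1} \<Longrightarrow> c t \<in> N"
    and r: "0 \<le> r" "\<And>t. t \<in> {0..1} \<Longrightarrow> G (c t) (c' t) (c' t) = r\<^sup>2"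
  shows "admissible G N (c 0) (c 1) c" "curve_length G c = r"
proof -
  have sp: "speed G c t = r" if "t \<in> {0..1}" for t
    using speed_at[OF that has_vector_derivative_at_within[OF d[OF that]]] r that by simp
  have "c C1_differentiable_on {0..1}"
    unfolding C1_differentiable_on_def using d c' by blast
  then have "valid_path c"
    by (simp add: valid_path_def C1_differentiable_imp_piecewise)
  moreover have "speed G c integrable_on {0..1}"
    by (rule integrable_eq[of "\<lambda>_. r"]) (use sp in auto)
  ultimately show "admissible G N (c 0) (c 1) c"
    using N by (auto simp: admissible_def path_image_def pathstart_def pathfinish_def)
  have "integral {0..1} (speed G c) = integral {0..1} (\<lambda>_::real. r)"
    by (rule integral_cong) (use sp in auto)
  then show "curve_length G c = r"
    by (simp add: curve_length_def)
qed

lemma valid_path_velocity: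
  assumes "valid_path c"
  obtains S D where "finite S" "{0,1} \<subseteq> S"
    "\<And>t. t \<in> {0..1} - S \<Longrightarrow> (c has_vector_derivative D t) (at t)"
    "continuous_on ({0..1} - S) D"
    "\<And>G t. t \<in> {0..1} - S \<Longrightarrow> speed G c t = sqrt (G (c t) (D t) (D t))"
proof -
  obtain S where S: "finite S" "c C1_differentiable_on ({0..1} - S)"
    using assms by (auto simp: valid_path_def piecewise_C1_differentiable_on_def)
  then obtain D where D: "\<And>t. t \<in> {0..1} - S \<Longrightarrow> (c has_vector_derivative D t) (at t)"
     "continuous_on ({0..1} - S) D"
    unfolding C1_differentiable_on_def by blast
  show thesis
  proof (rule that[of "S \<union> {0,1}" D])
    show "continuous_on ({0..1} - (S \<union> {0, 1})) D"
      by (rule continuous_on_subset[OF D(2)]) auto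
    show "speed G c t = sqrt (G (c t) (D t) (D t))" if "t \<in> {0..1} - (S \<union> {0, 1})" for G t
      by (rule speed_at) (use that D in \<open>auto intro: has_vector_derivative_at_within\<close>)
  qed (use S D in auto)
qed

lemma not_trivial_limit_unit: "t \<in> {0..1::real} \<Longrightarrow> at t within {0..1} \<noteq> bot"
  by (simp add: trivial_limit_within islimpt_Icc)

lemma SO_path_velocity:
  assumes "valid_path c" "path_image c \<subseteq> SO"
  obtains S D where "finite S" "{0,1} \<subseteq> S"
    "\<And>t. t \<in> {0..1} - S \<Longrightarrow> (c has_vector_derivative D t) (at t)"
    "continuous_on ({0..1} - S) D"
    "\<And>t. t \<in> {0..1} - S \<Longrightarrow> D t \<in> tangent_SO (c t)"
    "\<And>t. t \<in> {0..1} - S \<Longrightarrow> speed g_SO c t = norm (D t) / sqrt 2"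
proof -
  obtain S D where *: "finite S" "{0,1} \<subseteq> S"
    "\<And>t. t \<in> {0..1} - S \<Longrightarrow> (c has_vector_derivative D t) (at t)"
    "continuous_on ({0..1} - S) D"
    "\<And>G t. t \<in> {0..1} - S \<Longrightarrow> speed G c t = sqrt (G (c t) (D t) (D t))"
    using valid_path_velocity[OF assms(1)] by metis
  have inSO: "c t \<in> SO" if "t \<in> {0..1}" for t
    using assms(2) that by (auto simp: path_image_def)
  have tan: "D t \<in> tangent_SO (c t)" if "t \<in> {0..1} - S" for t
    by (rule tangent_SO_derivative[of t "{0..1}"])
       (use that not_trivial_limit_unit inSO * in \<open>auto intro: has_vector_derivative_at_within\<close>)
  show thesis
    by (rule that[OF *(1-4) tan]) (use *(5) tan in \<open>auto simp: g_SO_norm inSO\<close>)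
qed

text \<open>
  The speed of a piecewise smooth path is arbitrary at the break points; comparison of lengths has to
  ignore them.
\<close>

lemma integral_mono_finite:
  fixes f g :: "real \<Rightarrow> real"
  assumes "f integrable_on {a..b}" "g integrable_on {a..b}" "finite S"
    and le: "\<And>t. t \<in> {a..b} - S \<Longrightarrow> f t \<le> g t"
  shows "integral {a..b} f \<le> integral {a..b} g"
proof -
  define f' where "f' t = (if t \<in> S then g t else f t)" for t
  have "integral {a..b} f = integral {a..b} f'"
    by (rule integral_spike[of S]) (auto simp: f'_def assms)
  moreover have "f' integrable_on {a..b}"
    by (rule integrable_spike_finite[OF assms(3) _ assms(1)]) (auto simp: f'_def)
  then have "integral {a..b} f' \<le> integral {a..b} g"
    by (intro integral_le assms) (use le in \<open>auto simp: f'_def\<close>)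
  ultimately show ?thesis by simp
qed

lemma curve_length_nonneg:
  assumes "admissible G N a b c"
    and pos: "\<And>t v. t \<in> {0..1} \<Longrightarrow> (c has_vector_derivative v) (at t within {0..1}) \<Longrightarrow> 0 \<le> G (c t) v v"
  shows "0 \<le> curve_length G c"
proof -
  obtain S D where *: "finite S" "{0,1} \<subseteq> S"
    "\<And>t. t \<in> {0..1} - S \<Longrightarrow> (c has_vector_derivative D t) (at t)"
    "\<And>G t. t \<in> {0..1} - S \<Longrightarrow> speed G c t = sqrt (G (c t) (D t) (D t))"
    using assms(1) unfolding admissible_def by (metis valid_path_velocity)
  have "integral {0..1} (\<lambda>_::real. 0::real) \<le> integral {0..1} (speed G c)"
    by (rule integral_mono_finite[of _ _ _ _ S])
       (use assms(1) * pos has_vector_derivative_at_within[OF *(3)] in \<open>auto simp: admissible_def\<close>)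
  then show ?thesis by (simp add: curve_length_def)
qed

lemma admissible_in:
  assumes "admissible G N a b c" "t \<in> {0..1}"
  shows "c t \<in> N"
  using assms by (auto simp: admissible_def path_image_def)

lemma SO_length_nonneg:
  assumes "admissible g_SO SO a b c"
  shows "0 \<le> curve_length g_SO c"
proof (rule curve_length_nonneg[OF assms])
  fix t v assume t: "t \<in> {0..1::real}" "(c has_vector_derivative v) (at t within {0..1})"
  have "v \<in> tangent_SO (c t)"
    by (rule tangent_SO_derivative[OF t(1) not_trivial_limit_unit[OF t(1)] admissible_in[OF assms] t(2)])
  then show "0 \<le> g_SO (c t) v v"
    by (simp add: g_SO_norm admissible_in[OF assms t(1)])
qed

lemma SO_dist_le:
  assumes "admissible g_SO SO a b c"
  shows "riem_dist g_SO SO a b \<le> curve_length g_SO c"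
  unfolding riem_dist_admissible
  by (rule cInf_lower) (use assms SO_length_nonneg in \<open>auto intro!: bdd_belowI[of _ 0]\<close>)

lemma SO_dist_ge:
  assumes "admissible g_SO SO a b c" "\<And>c. admissible g_SO SO a b c \<Longrightarrow> r \<le> curve_length g_SO c"
  shows "r \<le> riem_dist g_SO SO a b"
  unfolding riem_dist_admissible
  by (rule cInf_greatest) (use assms in auto)

lemma has_vector_derivative_fst:
  "(c has_vector_derivative v) net \<Longrightarrow> ((\<lambda>t. fst (c t)) has_vector_derivative fst v) net"
  by (rule bounded_linear.has_vector_derivative[OF bounded_linear_fst])

lemma has_vector_derivative_snd:
  "(c has_vector_derivative v) net \<Longrightarrow> ((\<lambda>t. snd (c t)) has_vector_derivative snd v) net"
  by (rule bounded_linear.has_vector_derivative[OF bounded_linear_snd])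

lemma g_M_tangent:
  assumes "U \<in> SO" "A \<in> tangent_SO U" "\<And>i. a $ i > 0"
  shows "g_M k (U, diagm a) (A, diagm b) (A, diagm b)
       = k * (norm A)\<^sup>2 / 2 + (\<Sum>i\<in>UNIV. (b $ i / a $ i)\<^sup>2)"
proof -
  have "a $ i \<noteq> 0" for i using assms(3)[of i] by simp
  then show ?thesis
    using assms
    by (simp add: g_M_def g_SO_norm g_D_diagm power_divide power2_eq_square)
qed

lemma M_length_nonneg:
  assumes "k > 0" "admissible (g_M k) Mp a b c"
  shows "0 \<le> curve_length (g_M k) c"
proof (rule curve_length_nonneg[OF assms(2)])
  fix t v assume t: "t \<in> {0..1::real}" "(c has_vector_derivative v) (at t within {0..1})"
  have M: "fst (c s) \<in> SO" "snd (c s) \<in> DiagP" if "s \<in> {0..1}" for s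
    using admissible_in[OF assms(2) that] by (auto simp: Mp_def)
  have 1: "fst v \<in> tangent_SO (fst (c t))"
    by (rule tangent_SO_derivative[OF t(1) not_trivial_limit_unit[OF t(1)] M(1)
          has_vector_derivative_fst[OF t(2)]])
  have "diagonal_mat (snd v)"
    by (rule diagonal_derivative[OF t(1) not_trivial_limit_unit[OF t(1)] _
          has_vector_derivative_snd[OF t(2)]]) (use M(2) in \<open>auto simp: DiagP_def\<close>)
  then obtain b where b: "snd v = diagm b" using diagonal_mat_iff by blast
  obtain a where a: "snd (c t) = diagm a" "\<And>i. 0 < a $ i"
    using DiagP_obtain[OF M(2)[OF t(1)]] by metis
  have "g_M k (c t) v v = g_M k (fst (c t), diagm a) (fst v, diagm b) (fst v, diagm b)"
    using a b by (metis prod.collapse)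
  also have "\<dots> \<ge> 0"
    using assms(1) by (simp add: g_M_tangent[OF M(1)[OF t(1)] 1 a(2)] sum_nonneg)
  finally show "0 \<le> g_M k (c t) v v" .
qed

text \<open>
  The infimum defining \<open>d_SR\<close> is a lower bound only for a family bounded below. A distance \<open>d_M a b\<close>
  between points that no path joins would be the infimum of the empty set; this is one fixed real
  number, so the family is bounded below by its minimum with \<open>0\<close>.
\<close>

lemma F_minimal_geodesic_le:
  assumes "k > 0" "F_minimal_geodesic k X Y \<gamma>" "a \<in> fiber X" "b \<in> fiber Y"
    "admissible (g_M k) Mp a b c"
  shows "curve_length (g_M k) \<gamma> \<le> curve_length (g_M k) c"
proof -
  have low: "min 0 (Inf {}) \<le> d_M k a b" for a b :: "(real^'a^'a) \<times> (real^'a^'a)"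
  proof (cases "{curve_length (g_M k) c | c. admissible (g_M k) Mp a b c} = {}")
    case True
    then show ?thesis by (simp add: d_M_def riem_dist_admissible)
  next
    case False
    then have "0 \<le> d_M k a b"
      unfolding d_M_def riem_dist_admissible
      by (rule cInf_greatest) (use M_length_nonneg[OF assms(1)] in blast)+
    then show ?thesis by simp
  qed
  have "curve_length (g_M k) \<gamma> = d_SR k X Y"
    using assms(2) by (simp add: F_minimal_geodesic_def)
  also have "\<dots> \<le> d_M k a b"
    unfolding d_SR_def
  proof (rule cInf_lower)
    show "d_M k a b \<in> {d_M k a b |a b. a \<in> fiber X \<and> b \<in> fiber Y}"
      using assms by blast
    show "bdd_below {d_M k a b |a b. a \<in> fiber X \<and> b \<in> fiber Y}"
      by (rule bdd_belowI[of _ "min 0 (Inf {})"]) (use low in blast)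
  qed
  also have "\<dots> \<le> curve_length (g_M k) c"
    unfolding d_M_def riem_dist_admissible
  proof (rule cInf_lower)
    show "bdd_below {curve_length (g_M k) c |c. admissible (g_M k) Mp a b c}"
      by (rule bdd_belowI[of _ 0]) (use M_length_nonneg[OF assms(1)] in blast)
  qed (use assms in blast)
  finally show ?thesis .
qed

section \<open>Geodesics\<close>

lemma g_SO_has_derivative:
  "((\<lambda>s. g_SO (U + s *\<^sub>R H) A B) has_real_derivative
    - 1/2 * (trace ((transpose U ** A) ** (transpose H ** B))
           + trace ((transpose H ** A) ** (transpose U ** B)))) (at 0)"
proof -
  have "((\<lambda>s. (transpose U + s *\<^sub>R transpose H) ** C) has_vector_derivative transpose H ** C) (at 0)"
    for C :: "real^'a^'a"
    by (auto intro!: derivative_eq_intros matrix_mult.has_vector_derivative[THEN has_vector_derivative_eq_rhs]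
        simp: mat_distrib)
  note this[of A] this[of B]
  note bounded_linear.has_vector_derivative[OF bounded_linear_trace matrix_mult.has_vector_derivative[OF this]]
  then have "((\<lambda>s. trace ((transpose (U + s *\<^sub>R H) ** A) ** (transpose (U + s *\<^sub>R H) ** B)))
     has_real_derivative (trace ((transpose U ** A) ** (transpose H ** B))
           + trace ((transpose H ** A) ** (transpose U ** B)))) (at 0)"
    by (simp add: has_real_derivative_iff_has_vector_derivative trace_add mat_distrib)
  from DERIV_cmult[OF this, of "-1/2"] show ?thesis
    by (simp add: g_SO_def)
qed

text \<open>
  With \<open>\<Omega> = U\<^sup>T H\<close>, both derivatives reduce to traces of \<open>\<Omega>\<^sup>2 B\<close>, the product of a symmetric and a
  skew-symmetric matrix. Hence the terms of the geodesic equation that contain derivatives of the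
  metric vanish on \<open>SO(p)\<close>.
\<close>

lemma g_SO_derivative_along_curve:
  assumes "U \<in> SO" "H \<in> tangent_SO U" "skew B"
  shows "((\<lambda>s. g_SO (U + s *\<^sub>R H) H (U ** B)) has_real_derivative 0) (at 0)"
    and "((\<lambda>s. g_SO (U + s *\<^sub>R (U ** B)) H H) has_real_derivative 0) (at 0)"
proof -
  define \<Omega> where "\<Omega> = transpose U ** H"
  have H: "H = U ** \<Omega>" using assms(1) by (simp add: \<Omega>_def SO_D)
  have sk: "transpose \<Omega> = - \<Omega>" using assms(2) by (simp add: tangent_SO_def \<Omega>_def)
  have z: "trace ((\<Omega> ** \<Omega>) ** B) = 0" "trace (B ** (\<Omega> ** \<Omega>)) = 0"
    using trace_symmetric_skew[of "\<Omega> ** \<Omega>" B] assms(3) sk by (simp_all add: mat_distrib)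
  have UU: "transpose U ** U = mat 1" "transpose U ** (U ** C) = C" for C :: "real^'a^'a"
    using assms(1) by (simp_all add: SO_D)
  have 1: "transpose H ** H = - (\<Omega> ** \<Omega>)" "transpose H ** (U ** B) = - (\<Omega> ** B)"
    "transpose U ** (U ** B) = B" "transpose U ** H = \<Omega>"
    "transpose (U ** B) ** H = - (B ** \<Omega>)"
    using assms(3) by (simp_all add: H mat_distrib sk UU skew_def flip: matrix_mul_assoc)
  have "trace (\<Omega> ** - (\<Omega> ** B)) + trace (- (\<Omega> ** \<Omega>) ** B) = 0"
    using z by (simp add: mat_distrib trace_minus matrix_mul_assoc)
  then show "((\<lambda>s. g_SO (U + s *\<^sub>R H) H (U ** B)) has_real_derivative 0) (at 0)"
    using g_SO_has_derivative[of U H H "U ** B"] by (simp only: 1 mult_zero_right)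
  have "trace (\<Omega> ** (B ** \<Omega>)) = trace ((B ** \<Omega>) ** \<Omega>)" by (rule trace_mul_sym)
  then have "trace (\<Omega> ** - (B ** \<Omega>)) + trace (- (B ** \<Omega>) ** \<Omega>) = 0"
    using z by (simp add: mat_distrib trace_minus flip: matrix_mul_assoc)
  then show "((\<lambda>s. g_SO (U + s *\<^sub>R (U ** B)) H H) has_real_derivative 0) (at 0)"
    using g_SO_has_derivative[of U "U ** B" H H] by (simp only: 1 mult_zero_right)
qed

lemma g_D_has_derivative:
  fixes a b c l :: "real^'n"
  assumes "\<And>i. 0 < a $ i"
  shows "((\<lambda>s. g_D (diagm a + s *\<^sub>R diagm l) (diagm b) (diagm c)) has_real_derivative
    (\<Sum>i\<in>UNIV. - 2 * l $ i * b $ i * c $ i / (a $ i) ^ 3)) (at 0)"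
proof (rule has_field_derivative_transform_within_open)
  let ?S = "\<Inter>i\<in>UNIV. {s. 0 < a $ i + s * l $ i}"
  show "open ?S"
    by (intro open_INT ballI open_Collect_less continuous_intros) auto
  show "0 \<in> ?S" using assms by simp
  show "(\<Sum>i\<in>UNIV. b $ i * c $ i / (a $ i + s * l $ i)\<^sup>2) = g_D (diagm a + s *\<^sub>R diagm l) (diagm b) (diagm c)"
    if "s \<in> ?S" for s
  proof -
    have "a $ i + s * l $ i \<noteq> 0" for i
      using that by (metis (mono_tags, lifting) INT_E UNIV_I less_irrefl mem_Collect_eq)
    moreover have "diagm a + s *\<^sub>R diagm l = diagm (\<chi> i. a $ i + s * l $ i)"
      by (simp add: vec_eq_iff diagm_nth)
    ultimately show ?thesis by (simp add: g_D_diagm)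
  qed
  have "((\<lambda>s. b $ i * c $ i / (a $ i + s * l $ i)\<^sup>2) has_real_derivative
      - 2 * l $ i * b $ i * c $ i / (a $ i) ^ 3) (at 0)" for i
    using assms[of i]
    by (auto intro!: derivative_eq_intros simp: divide_simps power2_eq_square power3_eq_cube)
  then show "((\<lambda>s. \<Sum>i\<in>UNIV. b $ i * c $ i / (a $ i + s * l $ i)\<^sup>2) has_real_derivative
    (\<Sum>i\<in>UNIV. - 2 * l $ i * b $ i * c $ i / (a $ i) ^ 3)) (at 0)"
    by (rule DERIV_sum)
qed

text \<open>
  The diagonal of a geodesic of \<open>Diag\<^sup>+(p)\<close>: in logarithmic coordinates it is a straight line from
  \<open>log a\<close> with velocity \<open>l\<close>.
\<close>

definition scaling :: "real^'n \<Rightarrow> real^'n \<Rightarrow> real \<Rightarrow> real^'n" where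
  "scaling a l t = (\<chi> i. a $ i * exp (t * l $ i))"

lemma scaling_0: "scaling a l 0 = a"
  by (simp add: scaling_def vec_eq_iff)

lemma scaling_pos: "(\<And>i. 0 < a $ i) \<Longrightarrow> 0 < scaling a l t $ i"
  by (simp add: scaling_def)

text \<open>
  The geodesic equation of \<open>M(p)\<close> tested against \<open>(U B, diag c)\<close>. Its rotational part says that
  \<open>U\<^sup>T H''\<close> is symmetric, its diagonal part that \<open>b''/a = (b/a)\<^sup>2\<close> in every entry.
\<close>

lemma g_M_geodesic_equation:
  fixes a :: "real^'n"
  assumes U: "U \<in> SO" and H: "H \<in> tangent_SO U" and B: "skew B" and a: "\<And>i. 0 < a $ i"
  shows "g_M k (U, diagm a) (H'', diagm b'') (U ** B, diagm c)
      + metric_deriv (g_M k) (U, diagm a) (H, diagm b) (H, diagm b) (U ** B, diagm c)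
      - 1/2 * metric_deriv (g_M k) (U, diagm a) (U ** B, diagm c) (H, diagm b) (H, diagm b)
    = - k/2 * trace ((transpose U ** H'') ** B)
      + (\<Sum>i\<in>UNIV. c $ i * (b'' $ i / (a $ i)\<^sup>2 - (b $ i)\<^sup>2 / (a $ i) ^ 3))"
proof -
  have nz: "a $ i \<noteq> 0" for i using a[of i] by simp
  have 1: "g_M k (U, diagm a) (H'', diagm b'') (U ** B, diagm c)
      = - k/2 * trace ((transpose U ** H'') ** B) + (\<Sum>i\<in>UNIV. b'' $ i * c $ i / (a $ i)\<^sup>2)"
    using U nz by (simp add: g_M_def g_SO_def SO_D g_D_diagm)
  have 2: "metric_deriv (g_M k) (U, diagm a) (H, diagm b) (H, diagm b) (U ** B, diagm c)
      = (\<Sum>i\<in>UNIV. - 2 * b $ i * b $ i * c $ i / (a $ i) ^ 3)"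
    unfolding metric_deriv_def g_M_def
    by (rule DERIV_imp_deriv)
       (auto intro!: derivative_eq_intros g_SO_derivative_along_curve[OF U H B] g_D_has_derivative a)
  have 3: "metric_deriv (g_M k) (U, diagm a) (U ** B, diagm c) (H, diagm b) (H, diagm b)
      = (\<Sum>i\<in>UNIV. - 2 * c $ i * b $ i * b $ i / (a $ i) ^ 3)"
    unfolding metric_deriv_def g_M_def
    by (rule DERIV_imp_deriv)
       (auto intro!: derivative_eq_intros g_SO_derivative_along_curve[OF U H B] g_D_has_derivative a)
  have "c $ i * (b'' $ i / (a $ i)\<^sup>2 - (b $ i)\<^sup>2 / (a $ i) ^ 3)
      = b'' $ i * c $ i / (a $ i)\<^sup>2 + - 2 * b $ i * b $ i * c $ i / (a $ i) ^ 3
        - 1/2 * (- 2 * c $ i * b $ i * b $ i / (a $ i) ^ 3)" for i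
    by (simp add: power2_eq_square[of "b $ i"] right_diff_distrib mult_ac)
  then have "(\<Sum>i\<in>UNIV. c $ i * (b'' $ i / (a $ i)\<^sup>2 - (b $ i)\<^sup>2 / (a $ i) ^ 3))
      = (\<Sum>i\<in>UNIV. b'' $ i * c $ i / (a $ i)\<^sup>2)
        + (\<Sum>i\<in>UNIV. - 2 * b $ i * b $ i * c $ i / (a $ i) ^ 3)
        - 1/2 * (\<Sum>i\<in>UNIV. - 2 * c $ i * b $ i * b $ i / (a $ i) ^ 3)"
    by (simp only: sum.distrib sum_subtractf sum_distrib_left)
  then show ?thesis
    unfolding 1 2 3 by linarith
qed

lemma skew_conj:
  assumes "U \<in> SO" "H \<in> tangent_SO U"
  shows "skew (H ** transpose U)"
proof -
  have 1: "transpose H ** U = - (transpose U ** H)"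
    using assms(2) by (simp add: tangent_SO_def matrix_transpose_mul)
  have "transpose (H ** transpose U) = U ** (transpose H ** U) ** transpose U"
    using assms(1) by (simp add: matrix_transpose_mul SO_D flip: matrix_mul_assoc)
  also have "\<dots> = - (H ** transpose U)"
    unfolding 1 using assms(1) by (simp add: matrix_mult.minus_left matrix_mult.minus_right SO_D)
  finally show ?thesis by (simp add: skew_def)
qed

text \<open>
  Two first integrals solve the equation. For the rotation \<open>W\<close>, the matrix \<open>W' W\<^sup>T\<close> is constant: its
  derivative is skew-symmetric because \<open>W' W\<^sup>T\<close> is, and symmetric because \<open>W\<^sup>T W''\<close> is. For a diagonal
  entry \<open>d\<close>, the quotient \<open>d'/d\<close> is constant.
\<close>

lemma geodesic_M_form:
  fixes \<gamma> :: "real \<Rightarrow> (real^'n^'n) \<times> (real^'n^'n)"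
  assumes geo: "geodesic_on (g_M k) tangent_M Mp {0..1} \<gamma>" and k: "k > 0"
    and a: "snd (\<gamma> 0) = diagm a"
  obtains A l where "skew A"
    "\<And>t. t \<in> {0..1} \<Longrightarrow> \<gamma> t = (mexp A t ** fst (\<gamma> 0), diagm (scaling a l t))"
proof -
  have N: "\<And>t. t \<in> {0..1} \<Longrightarrow> \<gamma> t \<in> Mp"
    using geo by (simp add: geodesic_on_def)
  from geo have "\<exists>\<gamma>' \<gamma>''. \<forall>t\<in>{0..1}.
        (\<gamma> has_vector_derivative \<gamma>' t) (at t within {0..1}) \<and>
        (\<gamma>' has_vector_derivative \<gamma>'' t) (at t within {0..1}) \<and>
        (\<forall>w\<in>tangent_M (\<gamma> t).
           g_M k (\<gamma> t) (\<gamma>'' t) w + metric_deriv (g_M k) (\<gamma> t) (\<gamma>' t) (\<gamma>' t) w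
             - 1/2 * metric_deriv (g_M k) (\<gamma> t) w (\<gamma>' t) (\<gamma>' t) = 0)"
    unfolding geodesic_on_def by (rule conjunct2)
  then obtain \<gamma>' \<gamma>'' where *: "\<And>t. t \<in> {0..1} \<Longrightarrow>
        (\<gamma> has_vector_derivative \<gamma>' t) (at t within {0..1}) \<and>
        (\<gamma>' has_vector_derivative \<gamma>'' t) (at t within {0..1}) \<and>
        (\<forall>w\<in>tangent_M (\<gamma> t).
           g_M k (\<gamma> t) (\<gamma>'' t) w + metric_deriv (g_M k) (\<gamma> t) (\<gamma>' t) (\<gamma>' t) w
             - 1/2 * metric_deriv (g_M k) (\<gamma> t) w (\<gamma>' t) (\<gamma>' t) = 0)"
    by (elim exE) (rule that, erule (1) bspec)
  note d1 = conjunct1[OF *] and d2 = conjunct1[OF conjunct2[OF *]]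
    and eq = bspec[OF conjunct2[OF conjunct2[OF *]]]
  define W W' W'' where "W t = fst (\<gamma> t)" and "W' t = fst (\<gamma>' t)" and "W'' t = fst (\<gamma>'' t)" for t
  define d d' d'' where "d t = (\<chi> i. snd (\<gamma> t) $ i $ i)" and "d' t = (\<chi> i. snd (\<gamma>' t) $ i $ i)"
    and "d'' t = (\<chi> i. snd (\<gamma>'' t) $ i $ i)" for t
  note nt = not_trivial_limit_unit
  have W: "W t \<in> SO" and D: "snd (\<gamma> t) \<in> DiagP" if "t \<in> {0..1}" for t
    using N[OF that] by (auto simp: W_def Mp_def)
  have W1: "(W has_vector_derivative W' t) (at t within {0..1})"
    and W2: "(W' has_vector_derivative W'' t) (at t within {0..1})" if "t \<in> {0..1}" for t
    using has_vector_derivative_fst[OF d1[OF that]] has_vector_derivative_fst[OF d2[OF that]]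
    by (simp_all add: W_def[abs_def] W'_def[abs_def] W''_def)
  have diag0: "diagonal_mat (snd (\<gamma> t))" if "t \<in> {0..1}" for t
    using D[OF that] by (simp add: DiagP_def)
  have diag1: "diagonal_mat (snd (\<gamma>' t))" if "t \<in> {0..1}" for t
    by (rule diagonal_derivative[OF that nt[OF that] diag0 has_vector_derivative_snd[OF d1[OF that]]])
  have diag2: "diagonal_mat (snd (\<gamma>'' t))" if "t \<in> {0..1}" for t
    by (rule diagonal_derivative[OF that nt[OF that] diag1 has_vector_derivative_snd[OF d2[OF that]]])
  have tan: "W' t \<in> tangent_SO (W t)" if "t \<in> {0..1}" for t
    by (rule tangent_SO_derivative[OF that nt[OF that] W W1[OF that]])
  have dpos: "0 < d t $ i" if "t \<in> {0..1}" for t i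
    using D[OF that] by (simp add: d_def DiagP_def)
  have split: "\<gamma> t = (W t, diagm (d t))" "\<gamma>' t = (W' t, diagm (d' t))" "\<gamma>'' t = (W'' t, diagm (d'' t))"
    if "t \<in> {0..1}" for t
    using diagonal_eq_diagm[OF diag0[OF that]] diagonal_eq_diagm[OF diag1[OF that]]
      diagonal_eq_diagm[OF diag2[OF that]]
    by (simp_all add: W_def W'_def W''_def d_def d'_def d''_def prod_eq_iff)
  have main: "- k/2 * trace ((transpose (W t) ** W'' t) ** B)
      + (\<Sum>i\<in>UNIV. c $ i * (d'' t $ i / (d t $ i)\<^sup>2 - (d' t $ i)\<^sup>2 / (d t $ i) ^ 3)) = 0"
    if t: "t \<in> {0..1}" and B: "skew B" for t B c
  proof -
    have "skew (transpose (W t) ** (W t ** B))"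
      using B W[OF t] by (simp add: SO_D)
    then have "(W t ** B, diagm c) \<in> tangent_M (\<gamma> t)"
      by (simp add: tangent_M_def split[OF t] diagonal_diagm tangent_SO_of_skew)
    from eq[OF t this] show ?thesis
      unfolding split[OF t] g_M_geodesic_equation[OF W[OF t] tan[OF t] B dpos[OF t]] .
  qed
  define K where "K t = W' t ** transpose (W t)" for t
  have skK: "skew (K t)" if "t \<in> {0..1}" for t
    unfolding K_def by (rule skew_conj[OF W[OF that] tan[OF that]])
  have dK: "(K has_vector_derivative 0) (at t within {0..1})" if t: "t \<in> {0..1}" for t
  proof -
    define K' where "K' = W' t ** transpose (W' t) + W'' t ** transpose (W t)"
    have dK: "(K has_vector_derivative K') (at t within {0..1})"
      unfolding K'_def K_def[abs_def]
      by (intro matrix_mult.has_vector_derivative W1[OF t] W2[OF t]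
          bounded_linear.has_vector_derivative[OF bounded_linear_transpose])
    have "((\<lambda>t. transpose (K t)) has_vector_derivative transpose K') (at t within {0..1})"
      by (rule bounded_linear.has_vector_derivative[OF bounded_linear_transpose dK])
    moreover have "((\<lambda>t. transpose (K t)) has_vector_derivative - K') (at t within {0..1})"
      by (rule has_vector_derivative_transform[OF t _ has_vector_derivative_minus[OF dK]])
         (use skK in \<open>simp add: skew_def\<close>)
    ultimately have sk: "transpose K' = - K'"
      using vector_derivative_unique_within[OF nt[OF t]] by blast
    define S where "S = transpose (W t) ** W'' t"
    have "skew (transpose S - S)" by (simp add: skew_def mat_distrib)
    from main[OF t this, of 0] k have "trace (S ** (transpose S - S)) = 0"
      by (simp add: S_def)
    then have S: "transpose S = S" by (rule symmetricI_trace)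
    have WS: "W'' t = W t ** S" using W[OF t] by (simp add: S_def SO_D)
    have "transpose K' = K'"
      unfolding K'_def WS by (simp add: mat_distrib S matrix_mul_assoc)
    with sk have "K' = 0" by (metis eq_neg_iff_add_eq_0 scaleR_2 scaleR_eq_0_iff zero_neq_numeral)
    then show ?thesis using dK by simp
  qed
  define A where "A = K 0"
  have KA: "K t = A" if "t \<in> {0..1}" for t
    unfolding A_def by (rule has_vector_derivative_zero_eq[OF _ _ that dK]) auto
  have skA: "skew A" using skK[of 0] KA[of 0] by simp
  have "W' t = A ** W t" if "t \<in> {0..1}" for t
    using KA[OF that] W[OF that] by (metis K_def SO_D(1) matrix_mul_assoc matrix_mul_rid)
  then have Wt: "W t = mexp A t ** W 0" if "t \<in> {0..1}" for t
    using mexp_unique[of A "{0..1}" t W] W1 skA that by auto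
  have d1: "((\<lambda>t. d t $ i) has_real_derivative d' t $ i) (at t within {0..1})"
    and d2: "((\<lambda>t. d' t $ i) has_real_derivative d'' t $ i) (at t within {0..1})"
    if "t \<in> {0..1}" for t i
    using has_vector_derivative_entry[OF has_vector_derivative_snd[OF d1[OF that]], of i i]
      has_vector_derivative_entry[OF has_vector_derivative_snd[OF d2[OF that]], of i i]
    by (simp_all add: d_def d'_def d''_def has_real_derivative_iff_has_vector_derivative)
  have dd: "d'' t $ i * d t $ i = d' t $ i * d' t $ i" if t: "t \<in> {0..1}" for t i
  proof -
    have "(\<Sum>j\<in>UNIV. axis i 1 $ j * (d'' t $ j / (d t $ j)\<^sup>2 - (d' t $ j)\<^sup>2 / (d t $ j) ^ 3)) = 0"
      using main[OF t skew_intros(5), of "axis i 1"] by (simp add: mat_distrib trace_def)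
    then have "(\<Sum>j\<in>UNIV. if j = i then (d'' t $ j / (d t $ j)\<^sup>2 - (d' t $ j)\<^sup>2 / (d t $ j) ^ 3) else 0) = 0"
      by (simp add: axis_def if_distrib[of "\<lambda>x. x * _"] cong: if_cong)
    then show ?thesis
      using dpos[OF t, of i]
      by (simp add: divide_simps power2_eq_square power3_eq_cube)
  qed
  have "\<exists>l. \<forall>t\<in>{0..1}. d' t $ i / d t $ i = l" for i
  proof -
    have "((\<lambda>t. d' t $ i / d t $ i) has_real_derivative 0) (at t within {0..1})"
      if t: "t \<in> {0..1}" for t
      using DERIV_divide[OF d2[OF t, of i] d1[OF t, of i]] dd[OF t, of i] dpos[OF t, of i] by simp
    then show ?thesis
      by (intro has_field_derivative_zero_constant) auto
  qed
  then obtain l where l: "\<And>i t. t \<in> {0..1} \<Longrightarrow> d' t $ i / d t $ i = l i" by metis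
  have dt: "d t $ i = d 0 $ i * exp (t * l i)" if t: "t \<in> {0..1}" for t i
  proof -
    have "((\<lambda>t. d t $ i * exp (- (t * l i))) has_real_derivative 0) (at t within {0..1})"
      if t: "t \<in> {0..1}" for t
    proof -
      have "d' t $ i = l i * d t $ i" using l[OF t, of i] dpos[OF t, of i] by (simp add: field_simps)
      then show ?thesis
        by (auto intro!: derivative_eq_intros d1[OF t])
    qed
    then have "\<exists>c. \<forall>t\<in>{0..1}. d t $ i * exp (- (t * l i)) = c"
      by (intro has_field_derivative_zero_constant) auto
    then have "d t $ i * exp (- (t * l i)) = d 0 $ i * exp (- (0 * l i))"
      using t by (metis atLeastAtMost_iff order_refl zero_le_one)
    then show ?thesis by (simp add: exp_minus field_simps)
  qed
  have a0: "d 0 = a" using a by (simp add: d_def diagm_nth vec_eq_iff)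
  show thesis
  proof (rule that[OF skA])
    fix t :: real assume t: "t \<in> {0..1}"
    have "d t = scaling a (\<chi> i. l i) t"
      using dt[OF t] by (simp add: scaling_def vec_eq_iff a0)
    then show "\<gamma> t = (mexp A t ** fst (\<gamma> 0), diagm (scaling a (\<chi> i. l i) t))"
      using split(1)[OF t] Wt[OF t] by (simp add: W_def)
  qed
qed

text \<open>
  Membership in a cut locus asks for a geodesic defined for all times \<open>t \<ge> 0\<close>, which the prolonged
  exponential curve supplies.
\<close>

lemma mexp_geodesic_SO:
  assumes "skew A" "U \<in> SO"
  shows "geodesic_on g_SO tangent_SO SO S (\<lambda>t. mexp A t ** U)"
proof -
  have d: "((\<lambda>t. C ** (mexp A t ** U)) has_vector_derivative C ** (A ** (mexp A t ** U))) (at t within S)"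
    for C t
  proof -
    have "((\<lambda>t. C ** (mexp A t ** U)) has_vector_derivative
        C ** (mexp A t ** 0 + (A ** mexp A t) ** U) + 0 ** (mexp A t ** U)) (at t within S)"
      by (rule matrix_mult.has_vector_derivative[OF has_vector_derivative_const
            matrix_mult.has_vector_derivative[OF mexp_deriv has_vector_derivative_const]])
    then show ?thesis
      by (simp add: matrix_mult.zero_left matrix_mult.zero_right matrix_mul_assoc)
  qed
  have "g_SO V (A ** (A ** V)) w + metric_deriv g_SO V (A ** V) (A ** V) w
         - 1/2 * metric_deriv g_SO V w (A ** V) (A ** V) = 0"
    if V: "V \<in> SO" and w: "w \<in> tangent_SO V" for V w
  proof -
    define B where "B = transpose V ** w"
    have wB: "w = V ** B" using V by (simp add: B_def SO_D)
    have B: "skew B" using w by (simp add: tangent_SO_def B_def skew_def)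
    note tan = tangent_SO_I[OF V assms(1)]
    have "transpose (transpose V ** (A ** (A ** V))) = transpose V ** (A ** (A ** V))"
      using assms(1) by (simp add: mat_distrib skew_def matrix_mul_assoc)
    from trace_symmetric_skew(1)[OF this B] have "g_SO V (A ** (A ** V)) w = 0"
      using V by (simp add: g_SO_def wB SO_D)
    then show ?thesis
      unfolding wB metric_deriv_def
      using g_SO_derivative_along_curve[OF V tan B, THEN DERIV_imp_deriv] by simp
  qed
  note eq = this
  have SO: "mexp A t ** U \<in> SO" for t
    by (intro SO_mult mexp_SO assms)
  have 1: "((\<lambda>t. mexp A t ** U) has_vector_derivative A ** (mexp A t ** U)) (at t within S)" for t
    using d[of "mat 1"] by simp
  show ?thesis
    unfolding geodesic_on_def
    by (intro conjI ballI SO exI[of _ "\<lambda>t. A ** (mexp A t ** U)"]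
        exI[of _ "\<lambda>t. A ** (A ** (mexp A t ** U))"] 1 d eq)
qed

section \<open>Comparison paths\<close>

text \<open>
  The speed of a constructed path has to be shown integrable. Off the break points it is continuous,
  hence measurable, and it is dominated by an integrable function.
\<close>

lemma admissible_of_speed_bound:
  assumes "continuous_on {0..1} c" "finite S" "{0,1} \<subseteq> S"
    and d: "\<And>t. t \<in> {0..1} - S \<Longrightarrow> (c has_vector_derivative D t) (at t)"
    and D: "continuous_on ({0..1} - S) D" and N: "\<And>t. t \<in> {0..1} \<Longrightarrow> c t \<in> N"
    and s: "\<And>t. t \<in> {0..1} - S \<Longrightarrow> sqrt (G (c t) (D t) (D t)) = s t"
    and s0: "\<And>t. t \<in> {0..1} - S \<Longrightarrow> 0 \<le> s t" "continuous_on ({0..1} - S) s"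
    and g: "\<And>t. t \<in> {0..1} - S \<Longrightarrow> s t \<le> g t" "g integrable_on {0..1}"
  shows "admissible G N (c 0) (c 1) c" "curve_length G c \<le> integral {0..1} g"
proof -
  have sp: "speed G c t = s t" if "t \<in> {0..1} - S" for t
    using speed_at[OF _ has_vector_derivative_at_within[OF d[OF that]], of G] that s[OF that] by simp
  have neg: "negligible S" using assms(2) by (rule negligible_finite)
  have meas: "{0..1} - S \<in> sets lebesgue"
    by (intro sets.Diff) (use neg negligible_imp_sets in auto)
  have g': "g integrable_on ({0..1} - S)"
    by (rule integrable_spike_set[OF g(2)]) (auto intro: negligible_subset[OF neg])
  have "s integrable_on ({0..1} - S)"
    by (rule measurable_bounded_by_integrable_imp_integrable[OF
          continuous_imp_measurable_on_sets_lebesgue[OF s0(2) meas] g'])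
       (use s0 g meas in auto)
  then have "s integrable_on {0..1}"
    by (rule integrable_spike_set) (auto intro: negligible_subset[OF neg])
  then have int: "speed G c integrable_on {0..1}"
    by (rule integrable_spike_finite[OF assms(2), rotated]) (use sp in auto)
  have "c C1_differentiable_on ({0..1} - S)"
    unfolding C1_differentiable_on_def using d D by blast
  then have "valid_path c"
    using assms(1,2) by (auto simp: valid_path_def piecewise_C1_differentiable_on_def)
  then show "admissible G N (c 0) (c 1) c"
    using N int by (auto simp: admissible_def path_image_def pathstart_def pathfinish_def)
  show "curve_length G c \<le> integral {0..1} g"
    unfolding curve_length_def
    by (rule integral_mono_finite[OF int g(2) assms(2)]) (use sp g in auto)
qed

lemma continuous_on_diagm:
  assumes "\<And>i. continuous_on S (\<lambda>t. f t $ i)"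
  shows "continuous_on S (\<lambda>t. diagm (f t))"
  unfolding diagm_def
proof (intro continuous_on_vec_lambda)
  fix i j show "continuous_on S (\<lambda>t. if i = j then f t $ i else 0)"
    using assms by (cases "i = j") auto
qed

lemma diagm_has_derivative:
  assumes "\<And>i. ((\<lambda>t. f t $ i) has_real_derivative f' $ i) (at t within S)"
  shows "((\<lambda>t. diagm (f t)) has_vector_derivative diagm f') (at t within S)"
proof -
  have "((\<lambda>t. diagm (f t) $ i $ j) has_real_derivative diagm f' $ i $ j) (at t within S)" for i j
    using assms by (cases "i = j") (simp_all add: diagm_nth)
  then show ?thesis
    unfolding has_vector_derivative_def
    by (subst has_derivative_componentwise_within)
       (auto simp: Basis_vec_def inner_axis has_field_derivative_def mult_commute_abs)
qed

lemma scaling_has_derivative: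
  assumes "(\<sigma> has_real_derivative \<sigma>') (at t within S)"
  shows "((\<lambda>t. diagm (scaling a l (\<sigma> t))) has_vector_derivative
      diagm (\<chi> i. \<sigma>' * l $ i * scaling a l (\<sigma> t) $ i)) (at t within S)"
  by (rule diagm_has_derivative) (auto intro!: derivative_eq_intros assms simp: scaling_def)

lemma g_M_scaling:
  fixes l :: "real^'n"
  assumes "U \<in> SO" "H \<in> tangent_SO U" "\<And>i. 0 < a $ i"
  shows "g_M k (U, diagm (scaling a l s)) (H, diagm (\<chi> i. \<sigma>' * l $ i * scaling a l s $ i))
        (H, diagm (\<chi> i. \<sigma>' * l $ i * scaling a l s $ i)) = k * (norm H / sqrt 2)\<^sup>2 + (\<sigma>' * norm l)\<^sup>2"
proof -
  have pos: "0 < scaling a l s $ i" for i using assms(3) by (rule scaling_pos)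
  then have nz: "scaling a l s $ i \<noteq> 0" for i by (metis less_irrefl)
  have "(\<Sum>i\<in>UNIV. (\<sigma>' * l $ i)\<^sup>2) = (\<sigma>' * norm l)\<^sup>2"
    by (simp add: power_mult_distrib power2_norm_eq_inner inner_vec_def power2_eq_square[of "l $ _"]
        flip: sum_distrib_left)
  then show ?thesis
    by (simp add: g_M_tangent[OF assms(1,2) pos] nz power_divide)
qed

lemma geodesic_length:
  fixes a l :: "real^'n"
  assumes "skew A" "U \<in> SO" and a: "\<And>i. 0 < a $ i"
    and \<gamma>: "\<And>t. t \<in> {0..1} \<Longrightarrow> \<gamma> t = (mexp A t ** U, diagm (scaling a l t))"
  shows "curve_length (g_M k) \<gamma> = sqrt (k * (norm A / sqrt 2)\<^sup>2 + (norm l)\<^sup>2)"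
proof -
  have sp: "speed (g_M k) \<gamma> t = sqrt (k * (norm A / sqrt 2)\<^sup>2 + (norm l)\<^sup>2)"
    if t: "t \<in> {0..1}" for t
  proof -
    let ?V = "mexp A t ** U"
    have V: "?V \<in> SO" by (intro SO_mult mexp_SO assms)
    have "((\<lambda>t. mexp A t ** U) has_vector_derivative mexp A t ** 0 + (A ** mexp A t) ** U) (at t within {0..1})"
      by (rule matrix_mult.has_vector_derivative[OF mexp_deriv has_vector_derivative_const])
    then have "((\<lambda>t. mexp A t ** U) has_vector_derivative A ** ?V) (at t within {0..1})"
      by (simp add: matrix_mult.zero_right matrix_mul_assoc)
    from has_vector_derivative_Pair[OF this scaling_has_derivative[OF DERIV_ident]]
    have "(\<gamma> has_vector_derivative (A ** ?V, diagm (\<chi> i. 1 * l $ i * scaling a l t $ i))) (at t within {0..1})"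
      by (rule has_vector_derivative_transform[OF t, rotated]) (rule \<gamma>)
    from speed_at[OF t this, of "g_M k"]
      g_M_scaling[OF V tangent_SO_I[OF V assms(1)] a, where k = k and l = l and s = t and \<sigma>' = 1]
    show ?thesis by (simp add: \<gamma>[OF t] norm_SO_right[OF V])
  qed
  have "integral {0..1} (speed (g_M k) \<gamma>) = integral {0..1} (\<lambda>_::real. sqrt (k * (norm A / sqrt 2)\<^sup>2 + (norm l)\<^sup>2))"
    by (rule integral_cong) (rule sp)
  then show ?thesis by (simp add: curve_length_def)
qed

text \<open>
  Let \<open>c\<close> be a path in \<open>SO(p)\<close> from \<open>P\<close> to \<open>Q\<close> that is shorter than the rotational part of
  \<open>\<gamma>\<close>. It is completed to a path in \<open>M(p)\<close> by running through the diagonal part at the parameter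
  \<open>\<sigma>(t)\<close>, the normalized arc length of \<open>c\<close>. If \<open>c\<close> has length \<open>L\<close>, the completed path has length
  \<open>sqrt (k L\<^sup>2 + |l|\<^sup>2)\<close> up to an arbitrarily small margin, which is below the length of \<open>\<gamma>\<close>. Reparametrizing the diagonal part
  instead of \<open>c\<close> avoids inverting the arc length. The endpoints \<open>P\<close> and \<open>Q\<close> may differ from those of
  \<open>\<gamma>\<close>, since they only have to stay in the two fibers.
\<close>

lemma SO_part_minimal:
  fixes a l :: "real^'n"
  assumes k: "k > 0" and min: "F_minimal_geodesic k X Y \<gamma>"
    and A: "skew A" and U: "U \<in> SO" and a: "\<And>i. 0 < a $ i"
    and \<gamma>: "\<And>t. t \<in> {0..1} \<Longrightarrow> \<gamma> t = (mexp A t ** U, diagm (scaling a l t))"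
    and fib: "(P, diagm a) \<in> fiber X" "(Q, diagm (scaling a l 1)) \<in> fiber Y"
    and c: "admissible g_SO SO P Q c"
  shows "norm A / sqrt 2 \<le> curve_length g_SO c"
proof (rule ccontr)
  define r where "r = norm A / sqrt 2"
  define len where "len = curve_length g_SO c"
  \<comment> \<open>a margin that keeps the total length positive when \<open>c\<close> is constant\<close>
  define e where "e = (r - len) / 2"
  define tot where "tot = len + e"
  assume "\<not> norm A / sqrt 2 \<le> curve_length g_SO c"
  then have "len < r" by (simp add: r_def len_def)
  moreover have "0 \<le> len" unfolding len_def by (rule SO_length_nonneg[OF c])
  ultimately have e: "0 < e" "0 < tot" "tot < r" by (auto simp: e_def tot_def field_simps)
  have vc: "valid_path c" "path_image c \<subseteq> SO" "speed g_SO c integrable_on {0..1}"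
    "c 0 = P" "c 1 = Q"
    using c by (auto simp: admissible_def pathstart_def pathfinish_def)
  obtain S D where S: "finite S" "{0,1} \<subseteq> S"
    and D: "\<And>t. t \<in> {0..1} - S \<Longrightarrow> (c has_vector_derivative D t) (at t)"
      "continuous_on ({0..1} - S) D"
      "\<And>t. t \<in> {0..1} - S \<Longrightarrow> D t \<in> tangent_SO (c t)"
    and sp: "\<And>t. t \<in> {0..1} - S \<Longrightarrow> speed g_SO c t = norm (D t) / sqrt 2"
    using SO_path_velocity[OF vc(1,2)] by metis
  define m where "m = speed g_SO c"
  have cSO: "c t \<in> SO" if "t \<in> {0..1}" for t
    using admissible_in[OF c that] .
  have contm: "continuous_on ({0..1} - S) m"
    by (rule continuous_on_eq[of _ "\<lambda>t. norm (D t) / sqrt 2"])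
       (use sp in \<open>auto simp: m_def intro!: continuous_intros D(2)\<close>)
  define \<sigma> where "\<sigma> t = (integral {0..t} m + e * t) / tot" for t
  define \<sigma>' where "\<sigma>' t = (m t + e) / tot" for t
  have mint: "m integrable_on {0..1}" using vc(3) by (simp add: m_def)
  have c\<sigma>: "continuous_on {0..1} \<sigma>"
    unfolding \<sigma>_def
    using e by (intro continuous_intros indefinite_integral_continuous_1 mint) auto
  have \<sigma>0: "\<sigma> 0 = 0" and \<sigma>1: "\<sigma> 1 = 1"
    using e by (simp_all add: \<sigma>_def tot_def len_def m_def curve_length_def)
  have "{0..1} - S = {0<..<1} - S" using S(2) by (auto simp: less_le)
  then have op: "open ({0..1} - S)" using S(1) by (simp add: open_Diff finite_imp_closed)
  have d\<sigma>: "(\<sigma> has_real_derivative \<sigma>' t) (at t)" if t: "t \<in> {0..1} - S" for t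
  proof -
    have "((\<lambda>u. integral {0..u} m) has_vector_derivative m t) (at t within ({0..1} - S))"
      by (rule integral_has_vector_derivative_continuous_at[OF mint t S(1)])
         (use contm t in \<open>simp add: continuous_on_eq_continuous_within\<close>)
    then have "((\<lambda>u. integral {0..u} m) has_real_derivative m t) (at t)"
      by (simp only: at_within_open[OF t op] has_real_derivative_iff_has_vector_derivative)
    from DERIV_cdivide[OF DERIV_add[OF this DERIV_cmult_Id[of e]], of tot]
    show ?thesis unfolding \<sigma>_def \<sigma>'_def .
  qed
  have c\<sigma>': "continuous_on ({0..1} - S) \<sigma>'"
    unfolding \<sigma>'_def using e by (intro continuous_intros contm) auto
  define C where "C t = (c t, diagm (scaling a l (\<sigma> t)))" for t
  define C' where "C' t = (D t, diagm (\<chi> i. \<sigma>' t * l $ i * scaling a l (\<sigma> t) $ i))" for t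
  define s where "s t = sqrt (k * (m t)\<^sup>2 + (\<sigma>' t * norm l)\<^sup>2)" for t
  define \<kappa> where "\<kappa> = sqrt (k + (norm l / tot)\<^sup>2)"
  have c\<sigma>_sub: "continuous_on ({0..1} - S) \<sigma>" by (rule continuous_on_subset[OF c\<sigma>]) auto
  have contC: "continuous_on {0..1} C"
  proof -
    have "continuous_on {0..1} c"
      using vc(1) by (simp add: valid_path_def piecewise_C1_differentiable_on_def)
    moreover have "continuous_on {0..1} (\<lambda>t. diagm (scaling a l (\<sigma> t)))"
      by (rule continuous_on_diagm) (auto simp: scaling_def intro!: continuous_intros c\<sigma>)
    ultimately show ?thesis unfolding C_def by (intro continuous_on_Pair)
  qed
  have dC: "(C has_vector_derivative C' t) (at t)" if t: "t \<in> {0..1} - S" for t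
    unfolding C_def C'_def
    by (rule has_vector_derivative_Pair[OF D(1)[OF t] scaling_has_derivative[OF d\<sigma>[OF t]]])
  have contC': "continuous_on ({0..1} - S) C'"
    unfolding C'_def
    by (intro continuous_on_Pair D(2) continuous_on_diagm)
       (auto simp: scaling_def intro!: continuous_intros c\<sigma>_sub c\<sigma>')
  have CM: "C t \<in> Mp" if "t \<in> {0..1}" for t
    using cSO[OF that] by (simp add: C_def Mp_def DiagP_diagm scaling_pos[OF a])
  have Cs: "sqrt (g_M k (C t) (C' t) (C' t)) = s t" if t: "t \<in> {0..1} - S" for t
  proof -
    have "c t \<in> SO" using cSO t by simp
    from g_M_scaling[OF this D(3)[OF t] a] show ?thesis
      unfolding C_def C'_def s_def by (simp add: sp[OF t] m_def)
  qed
  have s_le: "s t \<le> \<kappa> * (m t + e)" if t: "t \<in> {0..1} - S" for t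
  proof -
    have m0: "0 \<le> m t" using sp[OF t] by (simp add: m_def)
    have eq: "(\<sigma>' t * norm l)\<^sup>2 = (norm l / tot)\<^sup>2 * (m t + e)\<^sup>2"
      by (simp add: \<sigma>'_def power_mult_distrib power_divide)
    have "(m t)\<^sup>2 \<le> (m t + e)\<^sup>2" using m0 e by (intro power_mono) auto
    then have "k * (m t)\<^sup>2 + (\<sigma>' t * norm l)\<^sup>2 \<le> k * (m t + e)\<^sup>2 + (\<sigma>' t * norm l)\<^sup>2"
      using k by simp
    also have "\<dots> = (k + (norm l / tot)\<^sup>2) * (m t + e)\<^sup>2"
      by (simp only: eq distrib_right)
    finally have "s t \<le> sqrt ((k + (norm l / tot)\<^sup>2) * (m t + e)\<^sup>2)"
      by (simp add: s_def)
    also have "\<dots> = \<kappa> * (m t + e)"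
      using m0 e by (simp add: \<kappa>_def real_sqrt_mult)
    finally show ?thesis .
  qed
  have conts: "continuous_on ({0..1} - S) s"
    unfolding s_def by (intro continuous_intros contm c\<sigma>')
  have s0: "0 \<le> s t" for t using k by (simp add: s_def)
  have int: "((\<lambda>t. \<kappa> * (m t + e)) has_integral \<kappa> * (len + e)) {0..1}"
  proof -
    have "(m has_integral len) {0..1}"
      using mint by (simp add: len_def m_def curve_length_def has_integral_integral)
    from has_integral_add[OF this has_integral_const_real[of e 0 1]]
    have "((\<lambda>t. m t + e) has_integral len + e) {0..1}" by simp
    then show ?thesis by (rule has_integral_mult_right)
  qed
  note adm = admissible_of_speed_bound[where G = "g_M k" and N = Mp, OF contC S dC contC' CM Cs s0 conts s_le
      has_integral_integrable[OF int]]
  have C01: "C 0 = (P, diagm a)" "C 1 = (Q, diagm (scaling a l 1))"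
    by (simp_all add: C_def vc \<sigma>0 \<sigma>1 scaling_0)
  have "curve_length (g_M k) \<gamma> \<le> curve_length (g_M k) C"
    by (rule F_minimal_geodesic_le[OF k min fib]) (use adm(1) C01 in simp)
  also have "\<dots> \<le> \<kappa> * tot"
    using adm(2) unfolding integral_unique[OF int] tot_def .
  also have "\<dots> = sqrt (k * tot\<^sup>2 + (norm l)\<^sup>2)"
  proof -
    have "\<kappa> * tot = sqrt ((k + (norm l / tot)\<^sup>2) * tot\<^sup>2)"
      using e by (simp add: \<kappa>_def real_sqrt_mult)
    also have "(k + (norm l / tot)\<^sup>2) * tot\<^sup>2 = k * tot\<^sup>2 + (norm l)\<^sup>2"
      using e by (simp add: power_divide algebra_simps)
    finally show ?thesis .
  qed
  also have "\<dots> < sqrt (k * r\<^sup>2 + (norm l)\<^sup>2)"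
    using e k by (simp add: power_strict_mono)
  also have "\<dots> = curve_length (g_M k) \<gamma>"
    unfolding r_def by (rule geodesic_length[OF A U a \<gamma>, symmetric])
  finally show False by simp
qed

text \<open>
  Left and right translations are isometries, and \<open>exp(s A)\<close> commutes with \<open>A\<close>, so the velocity
  \<open>exp(s A) (A + B) exp(s B) U\<close> has the norm of \<open>A + B\<close>. Compared with following the two geodesics
  one after the other, whose length is governed by \<open>|A| + |B|\<close>, this cuts the corner.
\<close>

lemma two_mexp_path:
  assumes A: "skew A" and B: "skew B" and U: "U \<in> SO"
  shows "admissible g_SO SO U (mexp A 1 ** mexp B 1 ** U) (\<lambda>t. mexp A t ** mexp B t ** U)"
    "curve_length g_SO (\<lambda>t. mexp A t ** mexp B t ** U) = norm (A + B) / sqrt 2"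
proof -
  let ?c = "\<lambda>t. mexp A t ** mexp B t ** U"
  let ?c' = "\<lambda>t. mexp A t ** ((A + B) ** (mexp B t ** U))"
  have SO: "?c t \<in> SO" for t by (intro SO_mult mexp_SO assms)
  have comm: "mexp A t ** A = A ** mexp A t" for t by (rule mexp_commute[OF A]) simp
  have d: "(?c has_vector_derivative ?c' t) (at t)" for t
  proof -
    have "(?c has_vector_derivative (mexp A t ** mexp B t) ** 0 +
        (mexp A t ** (B ** mexp B t) + (A ** mexp A t) ** mexp B t) ** U) (at t)"
      by (rule matrix_mult.has_vector_derivative[OF
            matrix_mult.has_vector_derivative[OF mexp_deriv mexp_deriv] has_vector_derivative_const])
    moreover have "(mexp A t ** mexp B t) ** 0 +
        (mexp A t ** (B ** mexp B t) + (A ** mexp A t) ** mexp B t) ** U = ?c' t"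
      by (simp add: matrix_mult.add_left matrix_mult.add_right matrix_mult.zero_right matrix_mul_assoc comm add.commute)
    ultimately show ?thesis by simp
  qed
  have cont: "continuous_on {0..1} ?c'"
  proof -
    have "continuous_on {0..1} (mexp C)" for C :: "real^'a^'a"
      by (rule continuous_on_vector_derivative[of _ _ "\<lambda>t. C ** mexp C t"]) (rule mexp_deriv)
    then show ?thesis by (intro matrix_mult.continuous_on continuous_on_const)
  qed
  have sp: "g_SO (?c t) (?c' t) (?c' t) = (norm (A + B) / sqrt 2)\<^sup>2" for t
  proof -
    have "?c' t \<in> tangent_SO (?c t)"
      by (rule tangent_SO_derivative[of t UNIV]) (use SO d in auto)
    moreover have "norm (?c' t) = norm (A + B)"
      by (simp add: norm_SO_left norm_SO_right mexp_SO assms SO_mult)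
    ultimately show ?thesis by (simp add: g_SO_norm[OF SO])
  qed
  have "0 \<le> norm (A + B) / sqrt 2" by simp
  note * = admissible_constant_speed[of ?c ?c' SO _ g_SO, OF d cont SO this sp]
  show "admissible g_SO SO U (mexp A 1 ** mexp B 1 ** U) ?c"
    using *(1) by (simp add: mexp_0)
  show "curve_length g_SO ?c = norm (A + B) / sqrt 2" by (rule *(2))
qed

lemma mexp_path:
  fixes A :: "real^'n^'n"
  assumes A: "skew A" and U: "U \<in> SO"
  shows "admissible g_SO SO U (mexp A 1 ** U) (\<lambda>t. mexp A t ** U)"
    "curve_length g_SO (\<lambda>t. mexp A t ** U) = norm A / sqrt 2"
proof -
  have "mexp (0 :: real^'n^'n) t = mat 1" for t
    using mexp_scaleR[of "0 :: real^'n^'n" 0 t] by (simp add: mexp_0 skew_def mat_distrib)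
  then show "admissible g_SO SO U (mexp A 1 ** U) (\<lambda>t. mexp A t ** U)"
    "curve_length g_SO (\<lambda>t. mexp A t ** U) = norm A / sqrt 2"
    using two_mexp_path[OF A skew_intros(5) U] by simp_all
qed

text \<open>
  This replaces the triangle inequality: moving the endpoint of \<open>c\<close> along a one-parameter group costs
  at most the length of the motion, because translating \<open>c\<close> gradually adds at most \<open>|B|\<close> to its
  velocity. No concatenation of paths is involved.
\<close>

lemma mexp_left_path:
  assumes B: "skew B" and c: "admissible g_SO SO P Q c"
  shows "admissible g_SO SO P (mexp B 1 ** Q) (\<lambda>t. mexp B t ** c t)"
    "curve_length g_SO (\<lambda>t. mexp B t ** c t) \<le> curve_length g_SO c + norm B / sqrt 2"
proof -
  have vc: "valid_path c" "path_image c \<subseteq> SO" "speed g_SO c integrable_on {0..1}"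
    "c 0 = P" "c 1 = Q"
    using c by (auto simp: admissible_def pathstart_def pathfinish_def)
  obtain S D where S: "finite S" "{0,1} \<subseteq> S"
    and D: "\<And>t. t \<in> {0..1} - S \<Longrightarrow> (c has_vector_derivative D t) (at t)"
      "continuous_on ({0..1} - S) D"
    and sp: "\<And>t. t \<in> {0..1} - S \<Longrightarrow> speed g_SO c t = norm (D t) / sqrt 2"
    using SO_path_velocity[OF vc(1,2)] by metis
  have cSO: "c t \<in> SO" if "t \<in> {0..1}" for t
    using admissible_in[OF c that] .
  let ?C = "\<lambda>t. mexp B t ** c t"
  let ?C' = "\<lambda>t. mexp B t ** D t + (B ** mexp B t) ** c t"
  have cont: "continuous_on T (mexp B)" for T
    by (rule continuous_on_vector_derivative[of _ _ "\<lambda>t. B ** mexp B t"]) (rule mexp_deriv)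
  have cc: "continuous_on {0..1} c"
    using vc(1) by (simp add: valid_path_def piecewise_C1_differentiable_on_def)
  have CSO: "?C t \<in> SO" if "t \<in> {0..1}" for t
    using cSO[OF that] by (intro SO_mult mexp_SO B)
  have d: "(?C has_vector_derivative ?C' t) (at t)" if t: "t \<in> {0..1} - S" for t
    by (rule matrix_mult.has_vector_derivative[OF mexp_deriv D(1)[OF t]])
  have s: "sqrt (g_SO (?C t) (?C' t) (?C' t)) = norm (?C' t) / sqrt 2" if t: "t \<in> {0..1} - S" for t
  proof -
    have "?C' t \<in> tangent_SO (?C t)"
      by (rule tangent_SO_derivative[of t "{0..1}"])
         (use t not_trivial_limit_unit CSO d in \<open>auto intro: has_vector_derivative_at_within\<close>)
    then show ?thesis using CSO t by (simp add: g_SO_norm)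
  qed
  have le: "norm (?C' t) / sqrt 2 \<le> speed g_SO c t + norm B / sqrt 2" if t: "t \<in> {0..1} - S" for t
  proof -
    have "norm (?C' t) \<le> norm (mexp B t ** D t) + norm ((B ** mexp B t) ** c t)"
      by (rule norm_triangle_ineq)
    also have "\<dots> = norm (D t) + norm B"
      using t by (simp add: norm_SO_left norm_SO_right mexp_SO B cSO)
    finally show ?thesis using sp[OF t] by (simp add: divide_simps)
  qed
  have int: "((\<lambda>t. speed g_SO c t + norm B / sqrt 2) has_integral curve_length g_SO c + norm B / sqrt 2) {0..1}"
  proof -
    have "(speed g_SO c has_integral curve_length g_SO c) {0..1}"
      using vc(3) by (simp add: curve_length_def has_integral_integral)
    from has_integral_add[OF this has_integral_const_real[of "norm B / sqrt 2" 0 1]]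
    show ?thesis by simp
  qed
  have 1: "continuous_on {0..1} ?C" by (intro matrix_mult.continuous_on cont cc)
  have cc': "continuous_on ({0..1} - S) c" by (rule continuous_on_subset[OF cc]) auto
  have 2: "continuous_on ({0..1} - S) ?C'"
    by (intro continuous_on_add matrix_mult.continuous_on cont cc' D(2) continuous_on_const)
  have 3: "continuous_on ({0..1} - S) (\<lambda>t. norm (?C' t) / sqrt 2)"
    by (intro continuous_on_divide continuous_on_norm 2 continuous_on_const) simp
  note * = admissible_of_speed_bound[of ?C S ?C' SO g_SO, OF 1 S d 2 CSO s _ 3 le has_integral_integrable[OF int]]
  show "admissible g_SO SO P (mexp B 1 ** Q) ?C"
    using *(1) vc by (simp add: mexp_0)
  show "curve_length g_SO ?C \<le> curve_length g_SO c + norm B / sqrt 2"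
    using *(2) integral_unique[OF int] by simp
qed

text \<open>
  Let \<open>r\<close> be the common length and \<open>E = A / r\<close>. Up to time \<open>r\<close> the geodesic \<open>exp(t E) U\<close> is
  minimizing, since its prolongation to \<open>r\<close> is. For \<open>t > r\<close> the same point is reached by \<open>B\<close>
  followed by \<open>(t - r) E\<close>; cutting this corner gives a path of length \<open>|(t - r) E + B|\<close>, which is
  less than \<open>t\<close> since \<open>E\<close> and \<open>B\<close> are not positively proportional.
\<close>

lemma cut_locus_two_minimal:
  assumes A: "skew A" and B: "skew B" and U: "U \<in> SO" and ne: "A \<noteq> B"
    and end_eq: "mexp A 1 = mexp B 1" and len: "norm A = norm B"
    and min: "\<And>c. admissible g_SO SO U (mexp A 1 ** U) c \<Longrightarrow> norm A / sqrt 2 \<le> curve_length g_SO c"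
  shows "mexp A 1 ** U \<in> cut_locus g_SO tangent_SO SO U"
proof -
  define r where "r = norm A / sqrt 2"
  have "norm A \<noteq> 0" using ne len by auto
  then have r: "r > 0" by (simp add: r_def)
  define E where "E = (1 / r) *\<^sub>R A"
  have skE: "skew E" unfolding E_def by (intro skew_intros A)
  have AE: "A = r *\<^sub>R E" using r by (simp add: E_def)
  have "norm A = r * sqrt 2" by (simp add: r_def)
  then have nE: "norm E = sqrt 2" using r by (simp add: E_def)
  define \<eta> where "\<eta> t = mexp E t ** U" for t
  have \<eta>SO: "\<eta> t \<in> SO" for t unfolding \<eta>_def by (intro SO_mult mexp_SO skE U)
  have scaled: "mexp (s *\<^sub>R E) 1 = mexp E s" for s by (simp add: mexp_scaleR[OF skE])
  have \<eta>r: "\<eta> r = mexp A 1 ** U" unfolding \<eta>_def AE scaled ..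
  have min': "r \<le> curve_length g_SO c" if "admissible g_SO SO U (\<eta> r) c" for c
    by (rule min[folded \<eta>r r_def, OF that])
  have sks: "skew (s *\<^sub>R E)" for s by (intro skew_intros skE)
  have \<eta>path: "admissible g_SO SO U (\<eta> t) (\<lambda>u. mexp (t *\<^sub>R E) u ** U)"
    "curve_length g_SO (\<lambda>u. mexp (t *\<^sub>R E) u ** U) = \<bar>t\<bar>" for t
    using mexp_path[OF sks U, of t] by (simp_all add: scaled \<eta>_def nE)
  have dist_le: "riem_dist g_SO SO U (\<eta> t) \<le> t" if "0 \<le> t" for t
    using SO_dist_le[OF \<eta>path(1), of t] \<eta>path(2)[of t] that by simp
  have dist_eq: "riem_dist g_SO SO U (\<eta> t) = t" if t: "0 \<le> t" "t \<le> r" for t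
  proof (rule antisym[OF dist_le[OF t(1)]])
    show "t \<le> riem_dist g_SO SO U (\<eta> t)"
    proof (rule SO_dist_ge[OF \<eta>path(1)])
      fix c assume c: "admissible g_SO SO U (\<eta> t) c"
      note p = mexp_left_path[OF sks c, of "r - t"]
      have "mexp ((r - t) *\<^sub>R E) 1 ** \<eta> t = \<eta> r"
        unfolding scaled \<eta>_def by (simp add: matrix_mul_assoc flip: mexp_add[OF skE])
      with p(1) have "r \<le> curve_length g_SO (\<lambda>u. mexp ((r - t) *\<^sub>R E) u ** c u)"
        by (intro min') simp
      also have "\<dots> \<le> curve_length g_SO c + (r - t)"
        using p(2) t by (simp add: nE)
      finally show "t \<le> curve_length g_SO c" by simp
    qed
  qed
  have dist_lt: "riem_dist g_SO SO U (\<eta> t) < t" if t: "r < t" for t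
  proof -
    note p = two_mexp_path[OF sks B U, of "t - r"]
    have "mexp ((t - r) *\<^sub>R E) 1 ** mexp B 1 ** U = \<eta> t"
      unfolding end_eq[symmetric] AE scaled \<eta>_def
      by (simp flip: mexp_add[OF skE])
    then have "riem_dist g_SO SO U (\<eta> t) \<le> norm ((t - r) *\<^sub>R E + B) / sqrt 2"
      using SO_dist_le[OF p(1)] p(2) by simp
    also have "\<dots> < t"
    proof -
      have nB: "norm B = r * sqrt 2" using len r by (simp add: r_def)
      have nt: "norm ((t - r) *\<^sub>R E) = (t - r) * sqrt 2" using t by (simp add: nE)
      have "norm ((t - r) *\<^sub>R E + B) \<noteq> norm ((t - r) *\<^sub>R E) + norm B"
      proof
        assume "norm ((t - r) *\<^sub>R E + B) = norm ((t - r) *\<^sub>R E) + norm B"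
        then have "norm ((t - r) *\<^sub>R E) *\<^sub>R B = norm B *\<^sub>R ((t - r) *\<^sub>R E)"
          by (simp only: norm_triangle_eq)
        then have "((t - r) * sqrt 2) *\<^sub>R B = (r * sqrt 2) *\<^sub>R ((t - r) *\<^sub>R E)"
          unfolding nt nB .
        then have "((t - r) * sqrt 2) *\<^sub>R B = ((t - r) * sqrt 2) *\<^sub>R A"
          by (simp add: AE mult_ac)
        then show False using ne t by simp
      qed
      then have "norm ((t - r) *\<^sub>R E + B) < norm ((t - r) *\<^sub>R E) + norm B"
        using norm_triangle_ineq[of "(t - r) *\<^sub>R E" B] by linarith
      also have "\<dots> = t * sqrt 2" unfolding nt nB by (simp add: algebra_simps)
      finally show ?thesis by (simp add: divide_less_eq)
    qed
    finally show ?thesis .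
  qed
  have set: "{t. 0 \<le> t \<and> riem_dist g_SO SO U (\<eta> t) = t} = {0..r}"
    using dist_eq dist_lt by (auto simp: not_le[symmetric]) (metis less_irrefl not_le)
  have geo: "geodesic_on g_SO tangent_SO SO {0..} \<eta>"
    unfolding \<eta>_def by (rule mexp_geodesic_SO[OF skE U])
  have unit: "let v = vector_derivative \<eta> (at t within {0..}) in g_SO (\<eta> t) v v = 1"
    if t: "0 \<le> t" for t
  proof -
    have "(\<eta> has_vector_derivative mexp E t ** 0 + (E ** mexp E t) ** U) (at t within {0..})"
      unfolding \<eta>_def
      by (rule matrix_mult.has_vector_derivative[OF mexp_deriv has_vector_derivative_const])
    then have "(\<eta> has_vector_derivative E ** \<eta> t) (at t within {0..})"
      by (simp add: matrix_mult.zero_right matrix_mul_assoc \<eta>_def)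
    moreover have "at t within {0..} \<noteq> bot"
    proof -
      have "t islimpt {t..t+1}" by (simp add: islimpt_Icc)
      then have "t islimpt {0..}" by (rule islimpt_subset) (use t in auto)
      then show ?thesis by (simp add: trivial_limit_within)
    qed
    ultimately have "vector_derivative \<eta> (at t within {0..}) = E ** \<eta> t"
      by (rule vector_derivative_within[rotated])
    then show ?thesis
      by (simp add: g_SO_norm[OF \<eta>SO tangent_SO_I[OF \<eta>SO skE]] norm_SO_right[OF \<eta>SO] nE)
  qed
  have "\<eta> 0 = U" by (simp add: \<eta>_def mexp_0)
  with geo unit set r show ?thesis
    unfolding cut_locus_def \<eta>r[symmetric] by blast
qed

section \<open>Right translations\<close>

lemma g_SO_right:
  fixes U A B h :: "real^'n^'n"
  assumes "h \<in> SO"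
  shows "g_SO (U ** h) (A ** h) (B ** h) = g_SO U A B"
proof -
  let ?M = "transpose U ** A" and ?N = "transpose U ** B"
  have "transpose (U ** h) ** (C ** h) = transpose h ** ((transpose U ** C) ** h)" for C :: "real^'n^'n"
    by (simp add: matrix_transpose_mul matrix_mul_assoc)
  then have "trace ((transpose (U ** h) ** (A ** h)) ** (transpose (U ** h) ** (B ** h)))
      = trace (transpose h ** (?M ** (h ** (transpose h ** (?N ** h)))))"
    by (simp add: matrix_mul_assoc)
  also have "\<dots> = trace ((?M ** (?N ** h)) ** transpose h)"
    using assms by (simp add: trace_mul_sym[of "transpose h"] SO_D)
  also have "\<dots> = trace (?M ** ?N)"
    using assms by (simp add: SO_D flip: matrix_mul_assoc)
  finally show ?thesis by (simp add: g_SO_def)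
qed

lemma tangent_SO_right:
  assumes "h \<in> SO" "A \<in> tangent_SO U"
  shows "A ** h \<in> tangent_SO (U ** h)"
proof -
  have "transpose (U ** h) ** (A ** h) = transpose h ** (transpose U ** A) ** h"
    by (simp add: matrix_transpose_mul matrix_mul_assoc)
  moreover have "transpose (transpose h ** S ** h) = transpose h ** transpose S ** h" for S :: "real^'a^'a"
    by (simp add: matrix_transpose_mul matrix_mul_assoc)
  ultimately show ?thesis
    using assms(2) by (simp add: tangent_SO_def matrix_mult.minus_left matrix_mult.minus_right)
qed

lemma metric_deriv_right:
  assumes "h \<in> SO"
  shows "metric_deriv g_SO (U ** h) (W ** h) (A ** h) (B ** h) = metric_deriv g_SO U W A B"
proof -
  have "U ** h + s *\<^sub>R (W ** h) = (U + s *\<^sub>R W) ** h" for s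
    by (simp add: matrix_mult.add_left matrix_mult.scaleR_left)
  then show ?thesis by (simp add: metric_deriv_def g_SO_right[OF assms])
qed

lemma has_vector_derivative_right:
  fixes h :: "real^'n^'n"
  assumes "(c has_vector_derivative v) net"
  shows "((\<lambda>t. c t ** h) has_vector_derivative v ** h) net"
  by (rule bounded_linear.has_vector_derivative[OF matrix_mult.bounded_linear_left assms])

lemma geodesic_on_right:
  assumes h: "h \<in> SO" and geo: "geodesic_on g_SO tangent_SO SO J \<gamma>"
  shows "geodesic_on g_SO tangent_SO SO J (\<lambda>t. \<gamma> t ** h)"
proof -
  from geo have N: "\<And>t. t \<in> J \<Longrightarrow> \<gamma> t \<in> SO" by (simp add: geodesic_on_def)
  from geo obtain \<gamma>' \<gamma>'' where *: "\<forall>t\<in>J.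
        (\<gamma> has_vector_derivative \<gamma>' t) (at t within J) \<and>
        (\<gamma>' has_vector_derivative \<gamma>'' t) (at t within J) \<and>
        (\<forall>w\<in>tangent_SO (\<gamma> t).
           g_SO (\<gamma> t) (\<gamma>'' t) w + metric_deriv g_SO (\<gamma> t) (\<gamma>' t) (\<gamma>' t) w
             - 1/2 * metric_deriv g_SO (\<gamma> t) w (\<gamma>' t) (\<gamma>' t) = 0)"
    unfolding geodesic_on_def by (elim conjE exE) (rule that)
  have "g_SO (\<gamma> t ** h) (\<gamma>'' t ** h) w + metric_deriv g_SO (\<gamma> t ** h) (\<gamma>' t ** h) (\<gamma>' t ** h) w
             - 1/2 * metric_deriv g_SO (\<gamma> t ** h) w (\<gamma>' t ** h) (\<gamma>' t ** h) = 0"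
    if t: "t \<in> J" and w: "w \<in> tangent_SO (\<gamma> t ** h)" for t w
  proof -
    define u where "u = w ** transpose h"
    have wu: "w = u ** h" using h by (simp add: u_def SO_D flip: matrix_mul_assoc)
    have "u \<in> tangent_SO ((\<gamma> t ** h) ** transpose h)"
      unfolding u_def by (rule tangent_SO_right[OF SO_transpose[OF h] w])
    then have "u \<in> tangent_SO (\<gamma> t)" using h by (simp add: SO_D flip: matrix_mul_assoc)
    then show ?thesis
      using * t by (simp add: wu g_SO_right[OF h] metric_deriv_right[OF h])
  qed
  note eq = this
  show ?thesis
    unfolding geodesic_on_def
    by (intro conjI ballI exI[of _ "\<lambda>t. \<gamma>' t ** h"] exI[of _ "\<lambda>t. \<gamma>'' t ** h"]
        has_vector_derivative_right SO_mult[OF N h] eq)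
       (use * in simp_all)
qed

lemma admissible_right:
  assumes h: "h \<in> SO" and c: "admissible g_SO SO P Q c"
  shows "admissible g_SO SO (P ** h) (Q ** h) (\<lambda>t. c t ** h)"
    "curve_length g_SO (\<lambda>t. c t ** h) = curve_length g_SO c"
proof -
  have vc: "valid_path c" "path_image c \<subseteq> SO" "speed g_SO c integrable_on {0..1}"
    "c 0 = P" "c 1 = Q"
    using c by (auto simp: admissible_def pathstart_def pathfinish_def)
  obtain S D where S: "finite S"
    and D: "\<And>t. t \<in> {0..1} - S \<Longrightarrow> (c has_vector_derivative D t) (at t)"
    and sp: "\<And>t. t \<in> {0..1} - S \<Longrightarrow> speed g_SO c t = sqrt (g_SO (c t) (D t) (D t))"
    using valid_path_velocity[OF vc(1)] by metis
  let ?c = "\<lambda>t. c t ** h"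
  have sp': "speed g_SO ?c t = speed g_SO c t" if t: "t \<in> {0..1} - S" for t
    using speed_at[OF _ has_vector_derivative_at_within[OF has_vector_derivative_right[OF D[OF t]]],
        of g_SO h] t sp[OF t] by (simp add: g_SO_right[OF h])
  have "valid_path ((\<lambda>A. A ** h) \<circ> c)"
    by (rule linear_image_valid_path[OF vc(1)])
       (rule bounded_linear.linear[OF matrix_mult.bounded_linear_left])
  then have "valid_path ?c" by (simp add: o_def)
  moreover have "speed g_SO ?c integrable_on {0..1}"
    by (rule integrable_spike_finite[OF S _ vc(3)]) (rule sp')
  ultimately show "admissible g_SO SO (P ** h) (Q ** h) ?c"
    using vc SO_mult[OF _ h] by (auto simp: admissible_def path_image_def pathstart_def pathfinish_def)
  show "curve_length g_SO ?c = curve_length g_SO c"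
    unfolding curve_length_def by (rule integral_spike[OF negligible_finite[OF S]]) (use sp' in auto)
qed

lemma SO_dist_right:
  fixes h :: "real^'n^'n"
  assumes h: "h \<in> SO"
  shows "riem_dist g_SO SO (P ** h) (Q ** h) = riem_dist g_SO SO P Q"
proof -
  have sub: "{curve_length g_SO c | c. admissible g_SO SO P Q c}
      \<subseteq> {curve_length g_SO c | c. admissible g_SO SO (P ** h) (Q ** h) c}"
    if "h \<in> SO" for P Q h :: "real^'n^'n"
    using admissible_right[OF that, of P Q] by (auto, metis)
  have "(P ** h) ** transpose h = P" "(Q ** h) ** transpose h = Q"
    using h by (simp_all add: SO_D flip: matrix_mul_assoc)
  then show ?thesis
    unfolding riem_dist_admissible
    using sub[OF h, of P Q] sub[OF SO_transpose[OF h], of "P ** h" "Q ** h"] by simp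
qed

lemma cut_locus_right:
  assumes h: "h \<in> SO" and x: "x \<in> cut_locus g_SO tangent_SO SO q"
  shows "x ** h \<in> cut_locus g_SO tangent_SO SO (q ** h)"
proof -
  from x obtain \<gamma> t0 where geo: "geodesic_on g_SO tangent_SO SO {0..} \<gamma>" and 0: "\<gamma> 0 = q"
    and unit: "\<forall>t\<ge>0. let v = vector_derivative \<gamma> (at t within {0..}) in g_SO (\<gamma> t) v v = 1"
    and t0: "0 < t0" "x = \<gamma> t0" and set: "{t. 0 \<le> t \<and> riem_dist g_SO SO q (\<gamma> t) = t} = {0..t0}"
    unfolding cut_locus_def by blast
  have "let v = vector_derivative (\<lambda>t. \<gamma> t ** h) (at t within {0..}) in g_SO (\<gamma> t ** h) v v = 1"
    if t: "0 \<le> t" for t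
  proof -
    from geo t obtain v where v: "(\<gamma> has_vector_derivative v) (at t within {0..})"
      unfolding geodesic_on_def by auto
    have nt: "at t within {0..} \<noteq> bot"
    proof -
      have "t islimpt {t..t+1}" by (simp add: islimpt_Icc)
      then have "t islimpt {0..}" by (rule islimpt_subset) (use t in auto)
      then show ?thesis by (simp add: trivial_limit_within)
    qed
    have "g_SO (\<gamma> t) v v = 1"
      using unit[rule_format, OF t] unfolding Let_def vector_derivative_within[OF nt v] .
    then show ?thesis
      by (simp add: vector_derivative_within[OF nt has_vector_derivative_right[OF v]] g_SO_right[OF h])
  qed
  moreover have "{t. 0 \<le> t \<and> riem_dist g_SO SO (q ** h) (\<gamma> t ** h) = t} = {0..t0}"
    using set by (simp add: SO_dist_right[OF h])
  ultimately show ?thesis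
    unfolding cut_locus_def using geodesic_on_right[OF h geo] 0 t0
    by (intro CollectI exI[of _ "\<lambda>t. \<gamma> t ** h"] exI[of _ t0]) simp
qed

text \<open>
  The metric is invariant under right translation by a rotation, and so is everything derived from it.
\<close>

lemma geod_antipodal_right:
  fixes h :: "real^'n^'n"
  assumes h: "h \<in> SO"
  shows "geod_antipodal (U ** h) (V ** h) \<longleftrightarrow> geod_antipodal U V"
proof -
  have "(P ** h) ** transpose h = P" for P :: "real^'n^'n"
    using h by (simp add: SO_D flip: matrix_mul_assoc)
  then show ?thesis
    unfolding geod_antipodal_def
    using cut_locus_right[OF h] cut_locus_right[OF SO_transpose[OF h]] by metis
qed

section \<open>Minimal arcs\<close>

text \<open>
  An \<open>F\<close>-minimal geodesic together with the data of its explicit form.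
\<close>

definition minimal_arc ::
  "real \<Rightarrow> real^'n^'n \<Rightarrow> real^'n^'n \<Rightarrow> real^'n^'n \<Rightarrow> real^'n^'n \<Rightarrow> real^'n \<Rightarrow> real^'n
     \<Rightarrow> (real \<Rightarrow> (real^'n^'n) \<times> (real^'n^'n)) \<Rightarrow> bool" where
  "minimal_arc k X Y A U a l \<gamma> \<longleftrightarrow> k > 0 \<and> F_minimal_geodesic k X Y \<gamma> \<and> skew A \<and> U \<in> SO \<and>
     (\<forall>i. 0 < a $ i) \<and> (\<forall>t\<in>{0..1}. \<gamma> t = (mexp A t ** U, diagm (scaling a l t)))"

lemma minimal_arcD:
  assumes "minimal_arc k X Y A U a l \<gamma>"
  shows "skew A" "U \<in> SO" "\<And>i. 0 < a $ i"
    "\<And>t. t \<in> {0..1} \<Longrightarrow> \<gamma> t = (mexp A t ** U, diagm (scaling a l t))"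
    "(U, diagm a) \<in> fiber X" "(mexp A 1 ** U, diagm (scaling a l 1)) \<in> fiber Y"
    "X = U ** diagm a ** transpose U"
proof -
  show \<gamma>: "\<And>t. t \<in> {0..1} \<Longrightarrow> \<gamma> t = (mexp A t ** U, diagm (scaling a l t))"
    and "skew A" "U \<in> SO" "\<And>i. 0 < a $ i"
    using assms by (simp_all add: minimal_arc_def)
  have "\<gamma> 0 \<in> fiber X" "\<gamma> 1 \<in> fiber Y"
    using assms by (simp_all only: minimal_arc_def F_minimal_geodesic_def)
  moreover have "\<gamma> 0 = (U, diagm a)" using \<gamma>[of 0] by (simp add: mexp_0 scaling_0)
  moreover have "\<gamma> 1 = (mexp A 1 ** U, diagm (scaling a l 1))" by (rule \<gamma>) simp
  ultimately show "(U, diagm a) \<in> fiber X" "(mexp A 1 ** U, diagm (scaling a l 1)) \<in> fiber Y"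
    by (simp_all only:)
  then show "X = U ** diagm a ** transpose U"
    by (simp add: fiber_def F_def)
qed

lemma minimal_arc_minimal:
  assumes "minimal_arc k X Y A U a l \<gamma>"
    and "(P, diagm a) \<in> fiber X" "(Q, diagm (scaling a l 1)) \<in> fiber Y" "admissible g_SO SO P Q c"
  shows "norm A / sqrt 2 \<le> curve_length g_SO c"
proof -
  have "k > 0" "F_minimal_geodesic k X Y \<gamma>"
    using assms(1) by (simp_all only: minimal_arc_def)
  from SO_part_minimal[OF this minimal_arcD(1-4)[OF assms(1)] assms(2-4)] show ?thesis .
qed

text \<open>
  If \<open>B\<close> commutes with \<open>X\<close>, the point \<open>exp(s B) U\<close> stays over \<open>X\<close>, and
  \<open>exp(r A) exp(- r s B) exp(s B) U\<close>, \<open>0 \<le> r \<le> 1\<close>, joins it to the endpoint of the arc. Minimality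
  gives \<open>|A| \<le> |A - s B|\<close> for all \<open>s\<close>, which means orthogonality.
\<close>

lemma minimal_arc_orthogonal:
  fixes A B X :: "real^'n^'n"
  assumes arc: "minimal_arc k X Y A U a l \<gamma>" and B: "skew B" "B ** X = X ** B"
  shows "A \<bullet> B = 0"
proof -
  note arcD = minimal_arcD[OF arc]
  have le: "norm A \<le> norm (A - s *\<^sub>R B)" for s
  proof -
    define P where "P = mexp B s ** U"
    have P: "P \<in> SO" unfolding P_def by (intro SO_mult mexp_SO B arcD)
    have sk: "skew (- s *\<^sub>R B)" by (rule skew_intros(3)[OF B(1)])
    have "mexp (- s *\<^sub>R B) 1 = mexp B (- s)"
      using mexp_scaleR[OF B(1), of "- s" 1] by (simp only: mult_1_right)
    then have E: "mexp (- s *\<^sub>R B) 1 ** P = U"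
      unfolding P_def by (simp add: matrix_mul_assoc mexp_cancel[OF B(1)])
    have "mexp B s ** X = X ** mexp B s" by (rule mexp_commute[OF B])
    then have "P ** diagm a ** transpose P = X ** (mexp B s ** transpose (mexp B s))"
      unfolding P_def arcD(7) matrix_transpose_mul by (simp only: matrix_mul_assoc)
    also have "\<dots> = X" by (simp add: SO_D mexp_SO B)
    finally have "(P, diagm a) \<in> fiber X"
      using P arcD(5) by (simp add: fiber_def F_def Mp_def)
    moreover have "admissible g_SO SO P (mexp A 1 ** U) (\<lambda>t. mexp A t ** mexp (- s *\<^sub>R B) t ** P)"
      using two_mexp_path(1)[OF arcD(1) sk P] E by (simp add: matrix_mul_assoc[symmetric])
    ultimately have "norm A / sqrt 2 \<le> curve_length g_SO (\<lambda>t. mexp A t ** mexp (- s *\<^sub>R B) t ** P)"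
      using minimal_arc_minimal[OF arc _ arcD(6)] by blast
    also have "\<dots> = norm (A + - s *\<^sub>R B) / sqrt 2" by (rule two_mexp_path(2)[OF arcD(1) sk P])
    finally show ?thesis by (simp add: divide_le_cancel)
  qed
  show ?thesis
  proof (cases "B = 0")
    case False
    \<comment> \<open>the minimizer of \<open>|A - s B|\<close>\<close>
    define s where "s = (A \<bullet> B) / (B \<bullet> B)"
    have bb: "B \<bullet> B > 0" using False by simp
    have "A \<bullet> A \<le> (A - s *\<^sub>R B) \<bullet> (A - s *\<^sub>R B)"
      using le[of s] by (simp add: norm_le)
    also have "\<dots> = A \<bullet> A - 2 * s * (A \<bullet> B) + s * s * (B \<bullet> B)"
      by (simp add: inner_diff_left inner_diff_right inner_commute algebra_simps)
    also have "s * s * (B \<bullet> B) = s * (A \<bullet> B)" using bb by (simp add: s_def)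
    finally have "s * (A \<bullet> B) \<le> 0" by simp
    then have "(A \<bullet> B) * (A \<bullet> B) \<le> 0" using bb by (simp add: s_def divide_le_0_iff)
    then show ?thesis using zero_le_square[of "A \<bullet> B"] by (metis antisym mult_eq_0_iff)
  qed simp
qed

text \<open>
  The two parts of the velocity: the rotation contributes a commutator with \<open>X\<close>, the scaling a matrix
  that is diagonalized by the same rotation as \<open>X\<close>.
\<close>

lemma sr_curve_initial_velocity:
  fixes A U :: "real^'n^'n"
  assumes U: "U \<in> SO" and A: "skew A" and X: "X = U ** diagm a ** transpose U"
    and eq: "\<And>t. t \<in> {0..1} \<Longrightarrow> f t = F (mexp A t ** U, diagm (scaling a l t))"
  obtains Z where "Z ** X = X ** Z"
    "(f has_vector_derivative A ** X - X ** A + Z) (at 0 within {0..1})"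
proof -
  define b where "b = (\<chi> i. 1 * l $ i * scaling a l 0 $ i)"
  define Z where "Z = U ** diagm b ** transpose U"
  have comm: "diagm b ** diagm a = diagm a ** diagm b"
    by (simp add: diagm_mult mult.commute)
  have "Z ** X = U ** (diagm b ** diagm a) ** transpose U"
    unfolding Z_def X using U by (simp add: SO_D flip: matrix_mul_assoc)
  also have "\<dots> = X ** Z"
    unfolding Z_def X comm using U by (simp add: SO_D flip: matrix_mul_assoc)
  finally have ZX: "Z ** X = X ** Z" .
  have W: "((\<lambda>t. mexp A t ** U) has_vector_derivative (A ** mexp A 0) ** U) (at 0 within {0..1})"
    by (rule has_vector_derivative_right[OF mexp_deriv])
  have \<delta>: "((\<lambda>t. diagm (scaling a l t)) has_vector_derivative diagm b) (at 0 within {0..1})"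
    unfolding b_def by (rule scaling_has_derivative[OF DERIV_ident])
  note matrix_mult.has_vector_derivative[OF matrix_mult.has_vector_derivative[OF W \<delta>]
      bounded_linear.has_vector_derivative[OF bounded_linear_transpose W]]
  moreover have "((mexp A 0 ** U) ** diagm (scaling a l 0)) ** transpose ((A ** mexp A 0) ** U)
      + ((mexp A 0 ** U) ** diagm b + ((A ** mexp A 0) ** U) ** diagm (scaling a l 0)) ** transpose (mexp A 0 ** U)
      = A ** X - X ** A + Z"
    using A unfolding X Z_def
    by (simp add: mexp_0 scaling_0 matrix_transpose_mul skew_def matrix_mult.minus_right matrix_mult.add_left
        matrix_mul_assoc)
  ultimately have "((\<lambda>t. (mexp A t ** U) ** diagm (scaling a l t) ** transpose (mexp A t ** U))
      has_vector_derivative A ** X - X ** A + Z) (at 0 within {0..1})"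
    by (simp only:)
  then have "(f has_vector_derivative A ** X - X ** A + Z) (at 0 within {0..1})"
    by (rule has_vector_derivative_transform[rotated 2]) (use eq in \<open>auto simp: F_def\<close>)
  with ZX show thesis by (rule that)
qed

text \<open>
  For \<open>N = A1 - A2\<close>, equality of the velocities makes \<open>M = [N, X]\<close> commute with \<open>X\<close>. Then
  \<open>tr(M M) = tr(M N X) - tr(M X N) = 0\<close>, and \<open>M\<close> is symmetric, so \<open>M = 0\<close>.
\<close>

lemma minimal_arcs_velocity_eq:
  fixes A1 A2 X :: "real^'n^'n"
  assumes arc1: "minimal_arc k X Y A1 U1 a l1 \<gamma>1" and arc2: "minimal_arc k X Y A2 U2 a l2 \<gamma>2"
    and eq: "\<And>t. t \<in> {0..1} \<Longrightarrow> F (\<gamma>1 t) = F (\<gamma>2 t)"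
  shows "A1 = A2"
proof -
  note arc1D = minimal_arcD[OF arc1] and arc2D = minimal_arcD[OF arc2]
  obtain Z1 where Z1: "Z1 ** X = X ** Z1"
    "((\<lambda>t. F (\<gamma>1 t)) has_vector_derivative A1 ** X - X ** A1 + Z1) (at 0 within {0..1})"
    using sr_curve_initial_velocity[OF arc1D(2,1,7), of "\<lambda>t. F (\<gamma>1 t)" l1] arc1D(4) by auto
  obtain Z2 where Z2: "Z2 ** X = X ** Z2"
    "((\<lambda>t. F (\<gamma>1 t)) has_vector_derivative A2 ** X - X ** A2 + Z2) (at 0 within {0..1})"
    using sr_curve_initial_velocity[OF arc2D(2,1,7), of "\<lambda>t. F (\<gamma>1 t)" l2] arc2D(4) eq by auto
  have "A1 ** X - X ** A1 + Z1 = A2 ** X - X ** A2 + Z2"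
    by (rule vector_derivative_unique_within[OF _ Z1(2) Z2(2)]) (simp add: not_trivial_limit_unit)
  define N where "N = A1 - A2"
  define M where "M = N ** X - X ** N"
  have skN: "skew N" unfolding N_def by (intro skew_intros arc1D arc2D)
  have MZ: "M = Z2 - Z1"
    using \<open>A1 ** X - X ** A1 + Z1 = A2 ** X - X ** A2 + Z2\<close>
    by (simp add: M_def N_def matrix_mult.diff_left matrix_mult.diff_right algebra_simps)
  have MX: "M ** X = X ** M"
    using Z1(1) Z2(1) by (simp add: MZ matrix_mult.diff_left matrix_mult.diff_right)
  have symX: "transpose X = X"
    unfolding arc1D(7) by (simp add: matrix_transpose_mul transpose_diagm matrix_mul_assoc)
  have symM: "transpose M = M"
    using skN by (simp add: M_def transpose_linear_simps matrix_transpose_mul symX skew_def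
        matrix_mult.minus_left matrix_mult.minus_right)
  have "M \<bullet> M = trace (M ** N ** X) - trace (M ** X ** N)"
    unfolding inner_eq_trace symM
    by (subst (2) M_def) (simp add: matrix_mult.diff_right trace_sub matrix_mul_assoc)
  also have "trace (M ** N ** X) = trace (X ** (M ** N))" by (rule trace_mul_sym)
  also have "\<dots> = trace (M ** X ** N)" by (simp add: MX matrix_mul_assoc)
  finally have "M = 0" by simp
  then have "N ** X = X ** N" by (simp add: M_def)
  then have "A1 \<bullet> N = 0" "A2 \<bullet> N = 0"
    using minimal_arc_orthogonal[OF arc1 skN] minimal_arc_orthogonal[OF arc2 skN] by auto
  then have "N \<bullet> N = 0" unfolding N_def by (metis inner_diff_left diff_self)
  then show ?thesis by (simp add: N_def)
qed

text \<open>
  Transporting either rotational geodesic to the starting point of the other compares their lengths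
  in both directions, so \<open>|A1| = |A2|\<close>, and different \<open>A1\<close>, \<open>A2\<close> would give a cut point.
\<close>

lemma nonantipodal_velocity_eq:
  fixes A1 A2 X :: "real^'n^'n"
  assumes arc1: "minimal_arc k X Y A1 U1 a l1 \<gamma>1" and arc2: "minimal_arc k X Y A2 U2 a l2 \<gamma>2"
    and eq: "mexp A1 1 = mexp A2 1" and na: "\<not> geod_antipodal U1 (mexp A1 1 ** U1)"
  shows "A1 = A2"
proof (rule ccontr)
  assume ne: "A1 \<noteq> A2"
  note arc1D = minimal_arcD[OF arc1] and arc2D = minimal_arcD[OF arc2]
  have min1: "norm A1 / sqrt 2 \<le> curve_length g_SO c"
    if "admissible g_SO SO U1 (mexp A1 1 ** U1) c" for c
    by (rule minimal_arc_minimal[OF arc1 arc1D(5,6) that])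
  have min2: "norm A2 / sqrt 2 \<le> curve_length g_SO c"
    if "admissible g_SO SO U2 (mexp A2 1 ** U2) c" for c
    by (rule minimal_arc_minimal[OF arc2 arc2D(5,6) that])
  have "norm A1 / sqrt 2 \<le> norm A2 / sqrt 2"
    using min1[unfolded eq, OF mexp_path(1)[OF arc2D(1) arc1D(2)]]
    by (simp only: mexp_path(2)[OF arc2D(1) arc1D(2)])
  moreover have "norm A2 / sqrt 2 \<le> norm A1 / sqrt 2"
    using min2[folded eq, OF mexp_path(1)[OF arc1D(1) arc2D(2)]]
    by (simp only: mexp_path(2)[OF arc1D(1) arc2D(2)])
  ultimately have "norm A1 = norm A2" by (simp add: divide_le_cancel)
  from cut_locus_two_minimal[OF arc1D(1) arc2D(1) arc1D(2) ne eq this min1]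
  show False using na by (simp add: geod_antipodal_def)
qed

section \<open>Stabilizers\<close>

lemma commutes_iff_stab:
  fixes R D :: "real^'n^'n"
  assumes "R \<in> SO"
  shows "R ** D ** transpose R = D \<longleftrightarrow> R ** D = D ** R"
proof
  assume "R ** D ** transpose R = D"
  then have "R ** D ** transpose R ** R = D ** R" by simp
  then show "R ** D = D ** R" using assms by (simp add: SO_D flip: matrix_mul_assoc)
next
  assume "R ** D = D ** R"
  then show "R ** D ** transpose R = D" using assms by (simp add: SO_D flip: matrix_mul_assoc)
qed

lemma stab2_iff: "R \<in> stab2 D L \<longleftrightarrow> R \<in> SO \<and> R ** D = D ** R \<and> R ** L = L ** R"
  using commutes_iff_stab by (auto simp: stab2_def stab_def)

lemma continuous_on_det:
  fixes f :: "'a::topological_space \<Rightarrow> real^'n^'n"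
  assumes "continuous_on S f"
  shows "continuous_on S (\<lambda>x. det (f x))"
  unfolding det_def by (intro continuous_intros assms)

text \<open>
  Compactness provides the maximum on which the choice of signs in \<open>sign_correction\<close> is based.
\<close>

lemma compact_stab2: "compact (stab2 D (L :: real^'n^'n))"
proof -
  have mult: "continuous_on UNIV (\<lambda>R. f R ** g R)"
    if "continuous_on UNIV f" "continuous_on UNIV g" for f g :: "real^'n^'n \<Rightarrow> real^'n^'n"
    by (rule matrix_mult.continuous_on[OF that])
  have tr: "continuous_on UNIV (transpose :: real^'n^'n \<Rightarrow> real^'n^'n)"
    by (rule linear_continuous_on[OF bounded_linear_transpose])
  have eq: "stab2 D L = {R. transpose R ** R = mat 1} \<inter> {R. det R = 1} \<inter> {R. R ** D = D ** R} \<inter> {R. R ** L = L ** R}"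
    by (auto simp: stab2_iff SO_I SO_D)
  have "closed (stab2 D L)"
    unfolding eq
    by (intro closed_Int closed_Collect_eq mult tr continuous_on_det continuous_on_const continuous_on_id)
  moreover have "bounded (stab2 D L)"
    unfolding bounded_iff
  proof (intro exI ballI)
    fix R assume "R \<in> stab2 D L"
    then show "norm R \<le> norm (mat 1 :: real^'n^'n)"
      using norm_SO_left[of R "mat 1"] by (simp add: stab2_iff)
  qed
  ultimately show ?thesis by (simp add: compact_eq_bounded_closed)
qed

lemma identity_component_subset: "identity_component H \<subseteq> H"
  unfolding identity_component_def by (rule connected_component_subset)

lemma identity_component_extend:
  assumes "W \<in> identity_component H" "W \<in> T" "connected T" "T \<subseteq> H"
  shows "T \<subseteq> identity_component H"
  using assms connected_component_maximal[OF assms(2-4)] connected_component_eq[of W H "mat 1"]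
  unfolding identity_component_def by blast

lemma transpose_identity_component:
  assumes "W \<in> identity_component (stab2 D L)"
    "transpose D = D" "transpose L = L"
  shows "transpose W \<in> identity_component (stab2 D L)"
proof -
  let ?C = "identity_component (stab2 D L)"
  have "connected ?C" by (simp add: identity_component_def)
  then have "connected (transpose ` ?C)"
    by (rule connected_continuous_image[OF linear_continuous_on[OF bounded_linear_transpose]])
  moreover have "transpose ` ?C \<subseteq> stab2 D L"
  proof
    fix R assume "R \<in> transpose ` ?C"
    then obtain V where V: "V \<in> stab2 D L" "R = transpose V"
      using identity_component_subset by blast
    have "transpose V ** E = E ** transpose V" if "V ** E = E ** V" "transpose E = E" for E
      using that by (metis matrix_transpose_mul)
    with V assms show "R \<in> stab2 D L"
      by (simp add: stab2_iff SO_transpose)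
  qed
  moreover have "mat 1 \<in> ?C"
    by (simp add: identity_component_def stab2_iff SO_one)
  moreover from this have "mat 1 \<in> transpose ` ?C" by (metis image_eqI transpose_mat)
  ultimately have "transpose ` ?C \<subseteq> ?C" by (intro identity_component_extend)
  then show ?thesis using assms(1) by blast
qed

text \<open>
  Every orthogonal \<open>M\<close> in the commutant of two diagonal matrices lies, up to a diagonal matrix of
  signs, in the identity component of the group of rotations there. Maximize \<open>tr(w W M)\<close> over \<open>W\<close> in
  that (compact) component, for a diagonal \<open>w\<close> with distinct nonnegative entries. At a maximum, with
  \<open>N = W M\<close>, the first-order condition in the direction \<open>B = (N w)\<^sup>T - N w\<close>, which is tangent to
  the component, makes \<open>N w\<close> symmetric. Then \<open>N\<close> commutes with \<open>w\<^sup>2\<close>, so it is diagonal, and being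
  orthogonal it has entries \<open>\<plusminus>1\<close>.
\<close>

lemma sign_correction:
  fixes M :: "real^'n^'n"
  assumes M: "transpose M ** M = mat 1" and MD: "M ** diagm d = diagm d ** M" "M ** diagm e = diagm e ** M"
  obtains s where "\<And>i. s $ i = 1 \<or> s $ i = -1"
    "M ** diagm s \<in> identity_component (stab2 (diagm d) (diagm e))"
proof -
  let ?H = "stab2 (diagm d) (diagm e)"
  let ?C = "identity_component ?H"
  define w :: "real^'n" where "w = (\<chi> i. real (to_nat i))"
  define f where "f W = trace (diagm w ** (W ** M))" for W
  have one: "mat 1 \<in> ?C" by (simp add: identity_component_def stab2_iff SO_one)
  have "compact ?C"
    unfolding identity_component_def
    by (metis closed_connected_component compact_Int_closed compact_imp_closed compact_stab2
        connected_component_subset inf.absorb_iff2)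
  moreover have "continuous_on ?C f"
    unfolding f_def
    by (intro bounded_linear.continuous_on[OF bounded_linear_trace] matrix_mult.continuous_on
        continuous_on_const continuous_on_id)
  ultimately obtain W where W: "W \<in> ?C" and max: "\<And>V. V \<in> ?C \<Longrightarrow> f V \<le> f W"
    using continuous_attains_sup[of ?C f] one by blast
  have WH: "W \<in> SO" "W ** diagm d = diagm d ** W" "W ** diagm e = diagm e ** W"
    using W identity_component_subset[of ?H] by (auto simp: stab2_iff)
  define N where "N = W ** M"
  have NN: "transpose N ** N = mat 1"
    using M WH(1) by (simp add: N_def matrix_transpose_mul SO_D flip: matrix_mul_assoc)
  have ND: "N ** diagm x = diagm x ** N" if "x \<in> {d, e}" for x
    using that MD WH unfolding N_def by (metis insertE matrix_mul_assoc singletonD)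
  define X where "X = N ** diagm w"
  have XD: "X ** diagm x = diagm x ** X" if "x \<in> {d, e}" for x
  proof -
    have "diagm w ** diagm x = diagm x ** diagm w" by (simp add: diagm_mult mult.commute)
    then show ?thesis unfolding X_def using ND[OF that] by (metis matrix_mul_assoc)
  qed
  define B where "B = transpose X - X"
  have skB: "skew B" by (simp add: B_def skew_def transpose_linear_simps)
  have BD: "B ** diagm x = diagm x ** B" if "x \<in> {d, e}" for x
  proof -
    have "transpose X ** diagm x = diagm x ** transpose X"
      using XD[OF that] by (metis matrix_transpose_mul transpose_diagm)
    then show ?thesis using XD[OF that] by (simp add: B_def matrix_mult.diff_left matrix_mult.diff_right)
  qed
  have "mexp B t ** W \<in> ?C" for t
  proof -
    have "range (\<lambda>t. mexp B t ** W) \<subseteq> ?C"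
    proof (rule identity_component_extend[OF W])
      show "W \<in> range (\<lambda>t. mexp B t ** W)"
        by (rule image_eqI[of _ _ 0]) (simp_all add: mexp_0)
      have "continuous_on UNIV (mexp B)"
        by (rule continuous_on_vector_derivative[of _ _ "\<lambda>t. B ** mexp B t"]) (rule mexp_deriv)
      then show "connected (range (\<lambda>t. mexp B t ** W))"
        by (intro connected_continuous_image matrix_mult.continuous_on continuous_on_const) auto
      have "(mexp B t ** W) ** diagm x = diagm x ** (mexp B t ** W)"
        if "x \<in> {d, e}" for x t
        using mexp_commute[OF skB BD[OF that], of t] WH that by (metis insertE matrix_mul_assoc singletonD)
      then show "range (\<lambda>t. mexp B t ** W) \<subseteq> ?H"
        by (auto simp: stab2_iff intro!: SO_mult mexp_SO skB WH(1))
    qed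
    then show ?thesis by blast
  qed
  then have le: "f (mexp B t ** W) \<le> f (mexp B 0 ** W)" for t
    using max by (simp add: mexp_0)
  have "((\<lambda>t. f (mexp B t ** W)) has_vector_derivative trace (diagm w ** (((B ** mexp B 0) ** W) ** M))) (at 0)"
    unfolding f_def
    by (rule bounded_linear.has_vector_derivative[OF bounded_linear_trace
          bounded_linear.has_vector_derivative[OF matrix_mult.bounded_linear_right
            has_vector_derivative_right[OF has_vector_derivative_right[OF mexp_deriv]]]])
  then have "((\<lambda>t. f (mexp B t ** W)) has_real_derivative trace (diagm w ** (B ** N))) (at 0)"
    by (simp add: has_real_derivative_iff_has_vector_derivative N_def mexp_0 matrix_mul_assoc)
  from DERIV_local_max[OF this, of 1] le have "trace (diagm w ** (B ** N)) = 0" by simp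
  moreover have "trace (diagm w ** (B ** N)) = trace ((B ** N) ** diagm w)" by (rule trace_mul_sym)
  moreover have "(B ** N) ** diagm w = B ** X" by (simp add: X_def matrix_mul_assoc)
  moreover have "trace (B ** X) = trace (X ** B)" by (rule trace_mul_sym)
  ultimately have "trace (X ** (transpose X - X)) = 0" by (simp add: B_def)
  then have symX: "diagm w ** transpose N = N ** diagm w"
    using symmetricI_trace[of X] by (simp add: X_def matrix_transpose_mul transpose_diagm)
  have "transpose N ** (diagm w ** transpose N) ** N = transpose N ** (N ** diagm w) ** N"
    by (simp only: symX)
  then have tN: "transpose N ** diagm w = diagm w ** N"
    using NN by (simp add: matrix_mul_assoc[symmetric]) (simp add: matrix_mul_assoc NN)
  have "N ** diagm w ** diagm w = diagm w ** diagm w ** N"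
    by (metis symX tN matrix_mul_assoc)
  then have "N $ i $ j * w $ j * w $ j = w $ i * w $ i * N $ i $ j" for i j
    using diagm_mult_right[of "N ** diagm w" w i j] diagm_mult_right[of N w i j]
      diagm_mult_left[of w "diagm w ** N" i j] diagm_mult_left[of w N i j]
    by (simp add: matrix_mul_assoc)
  then have "N $ i $ j = 0" if "i \<noteq> j" for i j
  proof -
    have "w $ i * w $ i \<noteq> w $ j * w $ j"
    proof
      assume "w $ i * w $ i = w $ j * w $ j"
      then have "w $ i = w $ j"
        by (simp add: w_def flip: power2_eq_square)
      then show False using that by (simp add: w_def)
    qed
    moreover have "N $ i $ j * (w $ j * w $ j - w $ i * w $ i) = 0"
      using \<open>\<And>j i. N $ i $ j * w $ j * w $ j = w $ i * w $ i * N $ i $ j\<close>[of i j]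
      by (simp add: algebra_simps)
    ultimately show ?thesis by simp
  qed
  then have "diagonal_mat N" by (simp add: diagonal_mat_def)
  then obtain s where s: "N = diagm s" using diagonal_mat_iff by blast
  have s1: "diagm (\<chi> i. s $ i * s $ i) = mat 1"
    using NN by (simp add: s transpose_diagm diagm_mult)
  have ss: "s $ i * s $ i = 1" for i
    using arg_cong[OF s1, of "\<lambda>T. T $ i $ i"] by (simp add: diagm_nth mat_def)
  have "M ** N = transpose W ** (N ** N)"
    using WH(1) by (simp add: N_def SO_D flip: matrix_mul_assoc)
  also have "N ** N = mat 1" using NN by (simp add: s transpose_diagm)
  finally have "M ** diagm s = transpose W" by (simp add: s)
  moreover have "transpose W \<in> ?C"
    by (rule transpose_identity_component[OF W]) (simp_all add: transpose_diagm)
  ultimately show thesis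
    using that[of s] ss by (simp add: square_eq_1_iff)
qed

text \<open>
  Since \<open>det Q \<noteq> 0\<close>, some permutation \<open>p\<close> has \<open>Q $ i $ p i \<noteq> 0\<close> for all \<open>i\<close>, and the two
  commutation relations then match the diagonal entries along \<open>p\<close>. With the permutation matrix \<open>P\<close> of
  \<open>p\<close>, the product \<open>Q P\<close> commutes with both diagonal matrices, and \<open>sign_correction\<close> applies. The
  resulting signed permutation is even because \<open>Q\<close> and \<open>R\<close> have determinant \<open>1\<close>.
\<close>

lemma intertwiner_factorization:
  fixes Q :: "real^'n^'n"
  assumes Q: "Q \<in> SO" and Qd: "Q ** diagm d = diagm d ** Q" and Qe: "Q ** diagm e2 = diagm e1 ** Q"
  obtains h R where "h \<in> even_signed_perms" "R \<in> identity_component (stab2 (diagm d) (diagm e1))"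
    "diagm d = perm_act (underlying_perm h) (diagm d)"
    "diagm e2 = perm_act (underlying_perm h) (diagm e1)"
    "Q = R ** matrix_inv h"
proof -
  have "det Q \<noteq> 0" using Q by (simp add: SO_D)
  then obtain p where p: "p permutes UNIV" and "of_int (sign p) * (\<Prod>i\<in>UNIV. Q $ i $ p i) \<noteq> 0"
    unfolding det_def by (metis (mono_tags, lifting) mem_Collect_eq sum.neutral)
  then have nz: "Q $ i $ p i \<noteq> 0" for i by auto
  have dp: "d $ p i = d $ i" for i
  proof -
    have "Q $ i $ p i * d $ p i = d $ i * Q $ i $ p i"
      using arg_cong[OF Qd, of "\<lambda>T. T $ i $ p i"] by (simp add: diagm_mult_left diagm_mult_right)
    then show ?thesis using nz[of i] by simp
  qed
  have ep: "e2 $ p i = e1 $ i" for i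
  proof -
    have "Q $ i $ p i * e2 $ p i = e1 $ i * Q $ i $ p i"
      using arg_cong[OF Qe, of "\<lambda>T. T $ i $ p i"] by (simp add: diagm_mult_left diagm_mult_right)
    then show ?thesis using nz[of i] by simp
  qed
  have bij: "bij p" using p by (simp add: permutes_bij)
  then have inj: "p i = p j \<longleftrightarrow> i = j" for i j by (metis bij_pointE)
  define P :: "real^'n^'n" where "P = (\<chi> i j. if i = p j then 1 else 0)"
  have P_nth: "P $ i $ j = (if i = p j then 1 else 0)" for i j by (simp add: P_def)
  have PP: "transpose P ** P = mat 1"
  proof -
    have "(transpose P ** P) $ i $ j = (if i = j then 1 else 0)" for i j
    proof -
      have "(transpose P ** P) $ i $ j = (\<Sum>k\<in>UNIV. P $ k $ i * P $ k $ j)"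
        by (simp add: matrix_matrix_mult_def transpose_def)
      also have "\<dots> = (\<Sum>k\<in>UNIV. if k = p i then (if i = j then 1 else 0) else 0)"
        by (rule sum.cong) (auto simp: P_nth inj)
      finally show ?thesis by simp
    qed
    then show ?thesis by (simp add: vec_eq_iff mat_def)
  qed
  have Pd: "P ** diagm d = diagm d ** P" and Pe: "P ** diagm e1 = diagm e2 ** P"
    by (auto simp: vec_eq_iff diagm_mult_left diagm_mult_right P_nth dp ep)
  have M1: "transpose (Q ** P) ** (Q ** P) = mat 1"
    using Q PP by (simp add: matrix_transpose_mul SO_D flip: matrix_mul_assoc)
  have M2: "(Q ** P) ** diagm d = diagm d ** (Q ** P)"
    using Qd Pd by (metis matrix_mul_assoc)
  have M3: "(Q ** P) ** diagm e1 = diagm e1 ** (Q ** P)"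
    using Qe Pe by (metis matrix_mul_assoc)
  obtain s where s: "\<And>i. s $ i = 1 \<or> s $ i = -1"
    and R: "(Q ** P) ** diagm s \<in> identity_component (stab2 (diagm d) (diagm e1))"
    using sign_correction[OF M1 M2 M3] by metis
  define h where "h = P ** diagm s"
  have h_nth: "h $ i $ j = (if i = p j then s $ j else 0)" for i j
    by (simp add: h_def diagm_mult_right P_nth)
  have s0: "s $ i \<noteq> 0" for i using s[of i] by auto
  have RSO: "Q ** h \<in> SO"
    using R identity_component_subset by (force simp: h_def stab2_iff matrix_mul_assoc)
  have "h = transpose Q ** (Q ** h)" using Q by (simp add: SO_D)
  then have hSO: "h \<in> SO" using SO_mult[OF SO_transpose[OF Q] RSO] by simp
  have inv: "p (inv p i) = i" for i using bij by (simp add: bij_is_surj surj_f_inv_f)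
  have h: "h \<in> even_signed_perms"
    unfolding even_signed_perms_def
  proof (intro CollectI conjI allI hSO)
    fix i j
    show "\<exists>!j. h $ i $ j \<noteq> 0"
      by (rule ex1I[of _ "inv p i"]) (auto simp: h_nth s0 inv bij inv_f_f bij_is_inj split: if_splits)
    show "\<exists>!i. h $ i $ j \<noteq> 0" by (auto simp: h_nth s0)
    show "h $ i $ j \<in> {0, 1, -1}" using s[of j] by (auto simp: h_nth)
  qed
  have up: "underlying_perm h = p"
    unfolding underlying_perm_def by (rule ext, rule the_equality) (auto simp: h_nth s0 split: if_splits)
  have invinj: "inv p i = inv p j \<longleftrightarrow> i = j" for i j by (metis inv)
  have 1: "diagm d = perm_act (underlying_perm h) (diagm d)"
    using dp[of "inv p _"] by (auto simp: up perm_act_def vec_eq_iff diagm_nth invinj inv)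
  have 2: "diagm e2 = perm_act (underlying_perm h) (diagm e1)"
    using ep[of "inv p _"] by (auto simp: up perm_act_def vec_eq_iff diagm_nth invinj inv)
  have "Q = (Q ** h) ** matrix_inv h"
    using hSO by (simp add: SO_inv SO_D flip: matrix_mul_assoc)
  with h R 1 2 show thesis
    by (intro that[of h "Q ** h"]) (simp_all add: h_def matrix_mul_assoc)
qed

text \<open>
  A nonzero entry \<open>T\<^sub>i\<^sub>j\<close> forces \<open>a\<^sub>j = a\<^sub>i\<close> at time \<open>0\<close> and then \<open>l\<^sub>j = m\<^sub>i\<close> at time \<open>1\<close>, so the
  entries agree at all times.
\<close>

lemma intertwines_scaling:
  assumes a: "\<And>i. 0 < a $ i" and T: "T ** diagm a = diagm a ** T"
    "T ** diagm (scaling a l 1) = diagm (scaling a m 1) ** T"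
  shows "T ** diagm (scaling a l t) = diagm (scaling a m t) ** T"
proof -
  have "T $ i $ j * scaling a l t $ j = scaling a m t $ i * T $ i $ j" for i j
  proof (cases "T $ i $ j = 0")
    case False
    have "T $ i $ j * a $ j = a $ i * T $ i $ j"
      using arg_cong[OF T(1), of "\<lambda>T. T $ i $ j"] by (simp add: diagm_mult_left diagm_mult_right)
    then have 1: "a $ j = a $ i" using False by simp
    have "T $ i $ j * scaling a l 1 $ j = scaling a m 1 $ i * T $ i $ j"
      using arg_cong[OF T(2), of "\<lambda>T. T $ i $ j"] by (simp add: diagm_mult_left diagm_mult_right)
    then have "scaling a l 1 $ j = scaling a m 1 $ i" using False by simp
    then have "l $ j = m $ i" using a[of i] 1 by (simp add: scaling_def)
    then show ?thesis using 1 by (simp add: scaling_def)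
  qed simp
  then show ?thesis by (simp add: vec_eq_iff diagm_mult_left diagm_mult_right)
qed


section \<open>Coincidence of minimal scaling-rotation curves\<close>

lemma SO_right_cancel:
  fixes A B U :: "real^'n^'n"
  assumes "U \<in> SO"
  shows "A ** U = B ** U \<longleftrightarrow> A = B"
proof
  assume "A ** U = B ** U"
  then have "A ** U ** transpose U = B ** U ** transpose U" by simp
  then show "A = B" using assms by (simp add: SO_D flip: matrix_mul_assoc)
qed simp

lemma minimal_arc_obtain:
  assumes "k > 0" "F_minimal_geodesic k X Y \<gamma>" "\<gamma> 0 = (U, diagm a)"
  obtains A l where "minimal_arc k X Y A U a l \<gamma>"
proof -
  have geo: "geodesic_on (g_M k) tangent_M Mp {0..1} \<gamma>"
    using assms(2) by (simp only: F_minimal_geodesic_def)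
  then have "\<gamma> 0 \<in> Mp" by (simp add: geodesic_on_def)
  then have U: "U \<in> SO" "\<And>i. 0 < a $ i" by (simp_all add: assms(3) Mp_def DiagP_diagm)
  obtain A l where "skew A"
    "\<And>t. t \<in> {0..1} \<Longrightarrow> \<gamma> t = (mexp A t ** fst (\<gamma> 0), diagm (scaling a l t))"
    using geodesic_M_form[OF geo assms(1), of a] assms(3) by auto
  then have "minimal_arc k X Y A U a l \<gamma>"
    using assms U by (simp add: minimal_arc_def)
  then show thesis by (rule that)
qed

lemma minimal_arc_velocity:
  assumes "minimal_arc k X Y A U a l \<gamma>"
  shows "proj_SO_velocity \<gamma> = A ** U"
proof -
  have "((\<lambda>t. mexp A t ** U) has_vector_derivative (A ** mexp A 0) ** U) (at 0 within {0..1})"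
    by (rule has_vector_derivative_right[OF mexp_deriv])
  from has_vector_derivative_Pair[OF this scaling_has_derivative[OF DERIV_ident]]
  have "(\<gamma> has_vector_derivative ((A ** mexp A 0) ** U, diagm (\<chi> i. 1 * l $ i * scaling a l 0 $ i)))
      (at 0 within {0..1})"
    by (rule has_vector_derivative_transform[rotated 2]) (use minimal_arcD(4)[OF assms] in auto)
  then have "vector_derivative \<gamma> (at 0 within {0..1})
      = ((A ** mexp A 0) ** U, diagm (\<chi> i. 1 * l $ i * scaling a l 0 $ i))"
    by (intro vector_derivative_within not_trivial_limit_unit) auto
  then show ?thesis by (simp add: proj_SO_velocity_def mexp_0)
qed

lemma F_eq_iff_intertwines:
  fixes U1 U2 E1 E2 :: "real^'n^'n"
  assumes "U1 \<in> SO" "U2 \<in> SO"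
  shows "F (U1, E1) = F (U2, E2) \<longleftrightarrow> (transpose U1 ** U2) ** E2 = E1 ** (transpose U1 ** U2)"
proof
  assume "F (U1, E1) = F (U2, E2)"
  then have "transpose U1 ** (U1 ** E1 ** transpose U1) ** U2 = transpose U1 ** (U2 ** E2 ** transpose U2) ** U2"
    by (simp add: F_def)
  then show "(transpose U1 ** U2) ** E2 = E1 ** (transpose U1 ** U2)"
    using assms by (simp add: SO_D flip: matrix_mul_assoc)
next
  assume *: "(transpose U1 ** U2) ** E2 = E1 ** (transpose U1 ** U2)"
  have "U2 ** E2 ** transpose U2 = U1 ** ((transpose U1 ** U2) ** E2) ** transpose U2"
    using assms by (simp add: SO_D flip: matrix_mul_assoc)
  also have "\<dots> = U1 ** E1 ** transpose U1"
    unfolding * using assms by (simp add: SO_D flip: matrix_mul_assoc)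
  finally show "F (U1, E1) = F (U2, E2)" by (simp add: F_def)
qed

lemma sr_curve_eq_iff: "sr_curve \<gamma> = sr_curve \<eta> \<longleftrightarrow> (\<forall>t\<in>{0..1}. F (\<gamma> t) = F (\<eta> t))"
proof
  assume "sr_curve \<gamma> = sr_curve \<eta>"
  then have "sr_curve \<gamma> t = sr_curve \<eta> t" for t by (rule fun_cong)
  then show "\<forall>t\<in>{0..1}. F (\<gamma> t) = F (\<eta> t)"
    unfolding sr_curve_def restrict_def o_def by (metis (no_types, lifting))
next
  assume "\<forall>t\<in>{0..1}. F (\<gamma> t) = F (\<eta> t)"
  then show "sr_curve \<gamma> = sr_curve \<eta>"
    by (intro ext) (simp add: sr_curve_def restrict_def)
qed

text \<open>
  Once the rotational velocities agree, the common rotation cancels from \<open>F \<circ> \<gamma>1\<close> and \<open>F \<circ> \<gamma>2\<close>, and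
  equality of the curves is an intertwining relation for \<open>U1\<^sup>T U2\<close>.
\<close>

lemma minimal_arcs_curve_eq_iff:
  fixes X Y :: "real^'n^'n"
  assumes arc1: "minimal_arc k X Y A1 U1 a l1 \<gamma>1" and arc2: "minimal_arc k X Y A2 U2 a l2 \<gamma>2"
  shows "(\<forall>t\<in>{0..1}. F (\<gamma>1 t) = F (\<gamma>2 t)) \<longleftrightarrow> A1 = A2 \<and>
    (\<exists>h\<in>even_signed_perms. \<exists>R\<in>identity_component (stab2 (diagm a) (diagm (scaling a l1 1))).
         diagm a = perm_act (underlying_perm h) (diagm a) \<and>
         diagm (scaling a l2 1) = perm_act (underlying_perm h) (diagm (scaling a l1 1)) \<and>
         transpose U1 ** U2 = R ** matrix_inv h)" (is "?L \<longleftrightarrow> _ \<and> ?R")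
proof -
  note arc1D = minimal_arcD[OF arc1] and arc2D = minimal_arcD[OF arc2]
  let ?Q = "transpose U1 ** U2"
  have Q: "?Q \<in> SO" by (intro SO_mult SO_transpose arc1D arc2D)
  have scaling_eq_iff: "?L \<longleftrightarrow> (\<forall>t\<in>{0..1}. ?Q ** diagm (scaling a l2 t) = diagm (scaling a l1 t) ** ?Q)"
    if "A1 = A2"
  proof (intro ball_cong refl)
    fix t :: real assume t: "t \<in> {0..1}"
    let ?E = "mexp A1 t"
    have E: "?E \<in> SO" by (rule mexp_SO[OF arc1D(1)])
    have "F (\<gamma>1 t) = F (\<gamma>2 t) \<longleftrightarrow>
        (transpose (?E ** U1) ** (?E ** U2)) ** diagm (scaling a l2 t)
        = diagm (scaling a l1 t) ** (transpose (?E ** U1) ** (?E ** U2))"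
      unfolding arc1D(4)[OF t] arc2D(4)[OF t] that[symmetric]
      by (rule F_eq_iff_intertwines) (intro SO_mult E arc1D arc2D)+
    also have "transpose (?E ** U1) ** (?E ** U2) = ?Q"
      using E by (simp add: matrix_transpose_mul SO_D flip: matrix_mul_assoc)
    finally show "F (\<gamma>1 t) = F (\<gamma>2 t) \<longleftrightarrow> ?Q ** diagm (scaling a l2 t) = diagm (scaling a l1 t) ** ?Q" .
  qed
  show ?thesis
  proof
    assume L: ?L
    then have A: "A1 = A2" by (intro minimal_arcs_velocity_eq[OF arc1 arc2]) blast
    then have eq: "?Q ** diagm (scaling a l2 t) = diagm (scaling a l1 t) ** ?Q" if "t \<in> {0..1}" for t
      using scaling_eq_iff L that by blast
    have "?Q ** diagm a = diagm a ** ?Q" using eq[of 0] by (simp add: scaling_0)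
    moreover have "?Q ** diagm (scaling a l2 1) = diagm (scaling a l1 1) ** ?Q" by (rule eq) simp
    ultimately have ?R
      by (rule intertwiner_factorization[OF Q]) blast
    with A show "A1 = A2 \<and> ?R" by blast
  next
    assume "A1 = A2 \<and> ?R"
    then obtain h R where A: "A1 = A2" and h: "h \<in> even_signed_perms"
      and R: "R \<in> identity_component (stab2 (diagm a) (diagm (scaling a l1 1)))"
      and ha: "diagm a = perm_act (underlying_perm h) (diagm a)"
      and hl: "diagm (scaling a l2 1) = perm_act (underlying_perm h) (diagm (scaling a l1 1))"
      and Q_eq: "?Q = R ** matrix_inv h" by blast
    have hSO: "h \<in> SO" using h by (simp add: even_signed_perms_def)
    have hc: "h ** E = E' ** h"
      if "E' = perm_act (underlying_perm h) E" "diagonal_mat E" for E E'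
      using that hSO by (simp add: perm_act_eq_conj[OF h] SO_inv SO_D flip: matrix_mul_assoc)
    have RH: "R ** diagm a = diagm a ** R" "R ** diagm (scaling a l1 1) = diagm (scaling a l1 1) ** R"
      using R identity_component_subset by (force simp: stab2_iff)+
    have "h ** diagm (scaling a l1 t) = diagm (scaling a l2 t) ** h" for t
      by (rule intertwines_scaling[OF arc1D(3) hc[OF ha] hc[OF hl]]) (rule diagonal_diagm)+
    then have 1: "transpose h ** diagm (scaling a l2 t) = diagm (scaling a l1 t) ** transpose h" for t
      by (metis matrix_transpose_mul transpose_diagm)
    have 2: "R ** diagm (scaling a l1 t) = diagm (scaling a l1 t) ** R" for t
      by (rule intertwines_scaling[OF arc1D(3) RH])
    have "?Q ** diagm (scaling a l2 t) = diagm (scaling a l1 t) ** ?Q" for t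
      unfolding Q_eq SO_inv[OF hSO] by (metis 1 2 matrix_mul_assoc)
    with scaling_eq_iff[OF A] show ?L by blast
  qed
qed

theorem proposition3p11:
  fixes k :: real
    and X Y U V D \<Lambda> :: "real ^ 'n::finite ^ 'n"
    and RU RV g \<Lambda>i :: "nat \<Rightarrow> real ^ 'n ^ 'n"
    and \<gamma> :: "nat \<Rightarrow> real \<Rightarrow> (real ^ 'n ^ 'n) \<times> (real ^ 'n ^ 'n)"
    and curve :: "nat \<Rightarrow> real \<Rightarrow> real ^ 'n ^ 'n"
  assumes "CARD('n) \<ge> 2" and "k > 0"
    and "X \<in> SymP" and "Y \<in> SymP" and "X \<noteq> Y"
    and "(U, D) \<in> fiber X" and "(V, \<Lambda>) \<in> fiber Y"
    and "\<And>i. i \<in> {1, 2} \<Longrightarrow> RU i \<in> identity_component (stab D)"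
    and "\<And>i. i \<in> {1, 2} \<Longrightarrow> RV i \<in> identity_component (stab \<Lambda>)"
    and "\<And>i. i \<in> {1, 2} \<Longrightarrow> g i \<in> even_signed_perms"
    and "\<And>i. i \<in> {1, 2} \<Longrightarrow> \<Lambda>i i = perm_act (underlying_perm (g i)) \<Lambda>"
    and "\<And>i. i \<in> {1, 2} \<Longrightarrow> F_minimal_geodesic k X Y (\<gamma> i)"
    and "\<And>i. i \<in> {1, 2} \<Longrightarrow>
           (\<gamma> i 0, \<gamma> i 1) = ((U ** RU i, D), (V ** RV i ** matrix_inv (g i), \<Lambda>i i))"
    and "\<And>i. i \<in> {1, 2} \<Longrightarrow> curve i = sr_curve (\<gamma> i)"
  shows "(curve 1 = curve 2 \<longleftrightarrow>
      (((\<forall>i\<in>{1, 2}. \<not> geod_antipodal (U ** RU i) (V ** RV i ** matrix_inv (g i))) \<and>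
        RV 2 ** matrix_inv (g 2) ** matrix_inv (RU 2) = RV 1 ** matrix_inv (g 1) ** matrix_inv (RU 1))
       \<or>
       ((\<forall>i\<in>{1, 2}. geod_antipodal (U ** RU i) (V ** RV i ** matrix_inv (g i))) \<and>
        proj_SO_velocity (\<gamma> 1) ** matrix_inv (RU 1) = proj_SO_velocity (\<gamma> 2) ** matrix_inv (RU 2)))
      \<and>
      (\<exists>h\<in>even_signed_perms. \<exists>R\<in>identity_component (stab2 D (\<Lambda>i 1)).
         D = perm_act (underlying_perm h) D \<and>
         \<Lambda>i 2 = perm_act (underlying_perm h) (\<Lambda>i 1) \<and>
         matrix_inv (RU 1) ** RU 2 = R ** matrix_inv h))
    \<and>
    (proj_SO_velocity (\<gamma> 1) ** matrix_inv (RU 1) = proj_SO_velocity (\<gamma> 2) ** matrix_inv (RU 2) \<longrightarrow>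
      RV 2 ** matrix_inv (g 2) ** matrix_inv (RU 2) = RV 1 ** matrix_inv (g 1) ** matrix_inv (RU 1))
    \<and>
    (curve 1 = curve 2 \<longrightarrow>
      RV 2 ** matrix_inv (g 2) ** matrix_inv (RU 2) = RV 1 ** matrix_inv (g 1) ** matrix_inv (RU 1))"
proof -
  have UX: "U \<in> SO" "D \<in> DiagP" and VY: "V \<in> SO"
    using assms(6,7) by (auto simp: fiber_def Mp_def)
  obtain a where D: "D = diagm a" using DiagP_obtain[OF UX(2)] by metis
  have SO: "RU i \<in> SO" "RV i \<in> SO" "g i \<in> SO" if "i \<in> {1, 2}" for i
    using assms(8)[OF that] assms(9)[OF that] assms(10)[OF that] identity_component_subset
    by (auto simp: stab_def even_signed_perms_def)
  have "\<exists>A l. minimal_arc k X Y A (U ** RU i) a l (\<gamma> i)" if "i \<in> {1, 2}" for i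
  proof -
    have "\<gamma> i 0 = (U ** RU i, diagm a)" using assms(13)[OF that] D by simp
    from minimal_arc_obtain[OF assms(2) assms(12)[OF that] this] show ?thesis by blast
  qed
  then obtain A l where arc: "\<And>i. i \<in> {1, 2} \<Longrightarrow> minimal_arc k X Y (A i) (U ** RU i) a (l i) (\<gamma> i)"
    by metis
  have end1: "V ** RV i ** matrix_inv (g i) = mexp (A i) 1 ** (U ** RU i)"
    and end2: "\<Lambda>i i = diagm (scaling a (l i) 1)" if "i \<in> {1, 2}" for i
    using minimal_arcD(4)[OF arc[OF that], of 1] assms(13)[OF that] by auto
  have endpoint: "RV i ** matrix_inv (g i) ** matrix_inv (RU i) = transpose V ** (mexp (A i) 1 ** U)"
    if i: "i \<in> {1, 2}" for i
  proof -
    have "RV i ** matrix_inv (g i) = transpose V ** (V ** RV i ** matrix_inv (g i))"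
      using VY by (simp add: SO_D flip: matrix_mul_assoc)
    then show ?thesis
      unfolding end1[OF i] using SO(1)[OF i] by (simp add: SO_inv SO_D flip: matrix_mul_assoc)
  qed
  have velocity: "proj_SO_velocity (\<gamma> i) ** matrix_inv (RU i) = A i ** U" if i: "i \<in> {1, 2}" for i
    unfolding minimal_arc_velocity[OF arc[OF i]]
    using SO(1)[OF i] by (simp add: SO_inv SO_D flip: matrix_mul_assoc)
  have I: "1 \<in> {1, 2 :: nat}" "2 \<in> {1, 2 :: nat}" by simp_all
  have vel_iff: "proj_SO_velocity (\<gamma> 1) ** matrix_inv (RU 1) = proj_SO_velocity (\<gamma> 2) ** matrix_inv (RU 2)
      \<longleftrightarrow> A 1 = A 2"
    unfolding velocity[OF I(1)] velocity[OF I(2)] by (rule SO_right_cancel[OF UX(1)])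
  have end_iff: "RV 2 ** matrix_inv (g 2) ** matrix_inv (RU 2) = RV 1 ** matrix_inv (g 1) ** matrix_inv (RU 1)
      \<longleftrightarrow> mexp (A 1) 1 = mexp (A 2) 1"
  proof -
    have "transpose V ** (mexp (A 2) 1 ** U) = transpose V ** (mexp (A 1) 1 ** U)
        \<longleftrightarrow> mexp (A 2) 1 ** U = mexp (A 1) 1 ** U"
      using SO_D(5)[OF VY] by metis
    then show ?thesis
      unfolding endpoint[OF I(1)] endpoint[OF I(2)] SO_right_cancel[OF UX(1)] by (rule trans[OF _ eq_commute])
  qed
  have antipodal: "geod_antipodal (U ** RU 1) (V ** RV 1 ** matrix_inv (g 1))
      \<longleftrightarrow> geod_antipodal (U ** RU 2) (V ** RV 2 ** matrix_inv (g 2))"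
    if E: "mexp (A 1) 1 = mexp (A 2) 1"
  proof -
    have h: "transpose (RU 1) ** RU 2 \<in> SO" by (intro SO_mult SO_transpose SO I)
    have "(P ** (U ** RU 1)) ** (transpose (RU 1) ** RU 2) = P ** (U ** RU 2)" for P
      using SO(1)[OF I(1)] by (simp add: SO_D flip: matrix_mul_assoc)
    from this[of "mat 1"] this[of "mexp (A 1) 1"] show ?thesis
      unfolding end1[OF I(1)] end1[OF I(2)] E[symmetric]
      using geod_antipodal_right[OF h, of "U ** RU 1" "mexp (A 1) 1 ** (U ** RU 1)"] by simp
  qed
  have nonantipodal: "A 1 = A 2"
    if "mexp (A 1) 1 = mexp (A 2) 1" "\<not> geod_antipodal (U ** RU 1) (V ** RV 1 ** matrix_inv (g 1))"
    using nonantipodal_velocity_eq[OF arc[OF I(1)] arc[OF I(2)] that(1)] that(2)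
    unfolding end1[OF I(1)] by blast
  have "transpose (U ** RU 1) ** (U ** RU 2) = matrix_inv (RU 1) ** RU 2"
    using UX(1) SO(1)[OF I(1)] by (simp add: matrix_transpose_mul SO_inv SO_D flip: matrix_mul_assoc)
  note curves = minimal_arcs_curve_eq_iff[OF arc[OF I(1)] arc[OF I(2)],
      unfolded this, folded D end2[OF I(1)] end2[OF I(2)]]
  have "curve 1 = curve 2 \<longleftrightarrow> (\<forall>t\<in>{0..1}. F (\<gamma> 1 t) = F (\<gamma> 2 t))"
    unfolding assms(14)[OF I(1)] assms(14)[OF I(2)] by (rule sr_curve_eq_iff)
  note curve_iff = this[unfolded curves]
  have ball: "(\<forall>i\<in>{1, 2}. P i) \<longleftrightarrow> P 1 \<and> P 2" for P :: "nat \<Rightarrow> bool" by simp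
  show ?thesis
    unfolding vel_iff end_iff curve_iff ball
    using antipodal nonantipodal by metis
qed

end
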